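(* Let $p\in[1,\infty)$, and let $E$ be a locally convex space. Then the following assertions are equivalent: (i) the identity operator $\mathrm{id}_E:E\to E$ is $p$-convergent, i.e., $E$ has the $p$-Schur property; (ii) any operator $S:\ell_{p^\ast}^0\to E$ (or $S:c_0^0\to E$ if $p=1$) is sequentially precompact. If $E$ is sequentially complete, then (i) and (ii) are equivalent to the following: (iii) any operator $S:\ell_{p^\ast}\to E$ (or $S:c_0\to E$ if $p=1$) is sequentially precompact. If $1<p<\infty$ and $E$ is sequentially complete, then (i)--(iii) are equivalent to the following: (iv) any operator $S:\ell_{p^\ast}\to E$ is sequentially compact. If $p=1$ and $E$ is sequentially complete and weakly sequentially $1$-complete, then (i)--(iii) are equivalent to: (v) any operator $S:c_0\to E$ is sequentially compact.
   Context: All locally convex spaces are Hausdorff, over $\mathbb{F}\in\{\mathbb{R},\mathbb{C}\}$. An operator is a continuous linear map. $p^\ast$ is the conjugate exponent, $\frac1p+\frac1{p^\ast}=1$. $\ell_{r}^0$ and $c_0^0$ denote the linear spans of the canonical unit vectors in $\ell_r$ and $c_0$, with the induced norms. A sequence $\{x_n\}_{n\in\omega}$ in $E$ is weakly $p$-summable ($p<\infty$) if $(\langle\chi,x_n\rangle)_n\in\ell_p$ for every $\chi\in E'$; weakly $p$-convergent to $x\in E$ if $\{x_n-x\}$ is weakly $p$-summable; weakly $p$-Cauchy if for each pair of strictly increasing sequences $(k_n),(j_n)\subseteq\omega$ the sequence $\{x_{k_n}-x_{j_n}\}_n$ is weakly $p$-summable. $E$ is weakly sequentially $p$-complete if every weakly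 $p$-Cauchy sequence in $E$ is weakly $p$-convergent to some point of $E$. $E$ is sequentially complete if every Cauchy sequence converges. A linear map is $p$-convergent if it sends weakly $p$-summable sequences to null sequences; $E$ has the $p$-Schur property if every weakly $p$-summable sequence in $E$ is a null sequence. A set $A\subseteq E$ is sequentially precompact if every sequence in $A$ has a Cauchy subsequence, and relatively sequentially compact if every sequence in $A$ has a subsequence converging to a point of $E$. An operator $S:Y\to E$ is sequentially precompact (resp. sequentially compact) if for some neighborhood $U$ of zero in $Y$ the set $S(U)$ is sequentially precompact (resp. relatively sequentially compact) in $E$. *)

theory Defs
  imports "HOL-Analysis.Analysis" "HOL-Library.Function_Algebras"
begin

section \<open>Scalars\<close>

text \<open>
  The types of this class are exactly the isometric copies of the fields of real and of
  complex numbers.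
\<close>

class real_or_complex_field = real_normed_field +
  assumes real_or_complex:
    "(\<exists>\<phi>::'a \<Rightarrow> real. bij \<phi> \<and> (\<forall>x y. \<phi> (x + y) = \<phi> x + \<phi> y) \<and>
        (\<forall>x y. \<phi> (x * y) = \<phi> x * \<phi> y) \<and> (\<forall>x. norm (\<phi> x) = norm x)) \<or>
     (\<exists>\<phi>::'a \<Rightarrow> complex. bij \<phi> \<and> (\<forall>x y. \<phi> (x + y) = \<phi> x + \<phi> y) \<and>
        (\<forall>x y. \<phi> (x * y) = \<phi> x * \<phi> y) \<and> (\<forall>x. norm (\<phi> x) = norm x))"

instance real :: real_or_complex_field
  by standard (intro disjI1 exI[of _ id], simp)

instance complex :: real_or_complex_field
  by standard (intro disjI2 exI[of _ id], simp)


section \<open>Locally convex spaces\<close>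

text \<open>
  The uniformity of a type in \<open>uniform_topological_group_add\<close> is determined by its
  topology (lemma \<open>uniformity_eq\<close> below), so the library predicate \<open>Cauchy\<close> is the usual
  notion of a Cauchy sequence in a topological vector space (lemma \<open>Cauchy_iff_nhds_0\<close>).
\<close>

locale locally_convex_space = vector_space smul
  for smul :: "'k::real_or_complex_field \<Rightarrow>
    'e::{uniform_topological_group_add, ab_group_add, t2_space} \<Rightarrow> 'e" +
  assumes continuous_scale: "continuous_on UNIV (\<lambda>(c, x). smul c x)"
    and convex_nhds_base:
      "\<And>U. open U \<Longrightarrow> 0 \<in> U \<Longrightarrow>
        \<exists>C\<subseteq>U. 0 \<in> interior C \<and>
          (\<forall>x\<in>C. \<forall>y\<in>C. \<forall>t::real. 0 \<le> t \<and> t \<le> 1 \<longrightarrow>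
            smul (of_real (1 - t)) x + smul (of_real t) y \<in> C)"

lemma uniformity_eq:
  "uniformity = filtercomap (\<lambda>(x, y). y - x :: 'e::uniform_topological_group_add) (nhds 0)"
  by (rule cauchy_seq_finset_iff_vanishing)

lemma Cauchy_iff_nhds_0:
  fixes x :: "nat \<Rightarrow> 'e::{uniform_topological_group_add, ab_group_add}"
  shows "Cauchy x \<longleftrightarrow> (\<forall>U. open U \<and> 0 \<in> U \<longrightarrow> (\<exists>N. \<forall>m\<ge>N. \<forall>n\<ge>N. x m - x n \<in> U))"
  unfolding Cauchy_uniform_iff uniformity_eq
proof (intro iffI allI impI; (elim conjE)?)
  fix U :: "'e set"
  assume C: "\<forall>P. eventually P (filtercomap (\<lambda>(x, y). y - x) (nhds (0::'e))) \<longrightarrow>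
      (\<exists>N. \<forall>n\<ge>N. \<forall>m\<ge>N. P (x n, x m))"
    and U: "open U" "0 \<in> U"
  have "eventually (\<lambda>(x, y). y - x \<in> U) (filtercomap (\<lambda>(x, y). y - x) (nhds (0::'e)))"
    unfolding eventually_filtercomap
    using eventually_nhds_in_open[OF U] by (intro exI[of _ "\<lambda>z. z \<in> U"]) auto
  from C[rule_format, OF this] show "\<exists>N. \<forall>m\<ge>N. \<forall>n\<ge>N. x m - x n \<in> U"
    by auto
next
  fix P :: "'e \<times> 'e \<Rightarrow> bool"
  assume C: "\<forall>U. open U \<and> 0 \<in> U \<longrightarrow> (\<exists>N. \<forall>m\<ge>N. \<forall>n\<ge>N. x m - x n \<in> U)"
    and P: "eventually P (filtercomap (\<lambda>(x, y). y - x) (nhds (0::'e)))"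
  from P obtain U where U: "open U" "0 \<in> U" "\<And>x y. y - x \<in> U \<Longrightarrow> P (x, y)"
    unfolding eventually_filtercomap eventually_nhds by fastforce
  then show "\<exists>N. \<forall>n\<ge>N. \<forall>m\<ge>N. P (x n, x m)"
    using C by meson
qed

definition continuous_dual ::
  "('k::real_or_complex_field \<Rightarrow> 'e::{topological_space, ab_group_add} \<Rightarrow> 'e) \<Rightarrow> ('e \<Rightarrow> 'k) set"
  where "continuous_dual smul =
    {f. Vector_Spaces.linear smul (*) f \<and> continuous_on UNIV f}"

definition sequentially_complete :: "'e::uniform_space itself \<Rightarrow> bool"
  where "sequentially_complete _ \<longleftrightarrow> (\<forall>x::nat \<Rightarrow> 'e. Cauchy x \<longrightarrow> convergent x)"

definition sequentially_precompact :: "'e::uniform_space set \<Rightarrow> bool"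
  where "sequentially_precompact A \<longleftrightarrow>
    (\<forall>x::nat \<Rightarrow> 'e. range x \<subseteq> A \<longrightarrow> (\<exists>r::nat \<Rightarrow> nat. strict_mono r \<and> Cauchy (x \<circ> r)))"

text \<open>Unlike in \<open>seq_compact\<close>, the limit need not lie in the set.\<close>

definition relatively_sequentially_compact :: "'e::topological_space set \<Rightarrow> bool"
  where "relatively_sequentially_compact A \<longleftrightarrow>
    (\<forall>x::nat \<Rightarrow> 'e. range x \<subseteq> A \<longrightarrow> (\<exists>r::nat \<Rightarrow> nat. strict_mono r \<and> convergent (x \<circ> r)))"


section \<open>Sequence spaces\<close>

definition lp :: "real \<Rightarrow> (nat \<Rightarrow> 'k::real_normed_vector) set"
  where "lp r = {a. summable (\<lambda>n. norm (a n) powr r)}"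

definition lp_norm :: "real \<Rightarrow> (nat \<Rightarrow> 'k::real_normed_vector) \<Rightarrow> real"
  where "lp_norm r a = (\<Sum>n. norm (a n) powr r) powr (1 / r)"

definition c0 :: "(nat \<Rightarrow> 'k::real_normed_vector) set"
  where "c0 = {a. a \<longlonglongrightarrow> 0}"

text \<open>
  The value on unbounded sequences is irrelevant; it is fixed to 0 because \<open>Metric_space\<close>
  requires a distance that is nonnegative everywhere, and \<open>SUP\<close> is unspecified there.
\<close>

definition sup_norm :: "(nat \<Rightarrow> 'k::real_normed_vector) \<Rightarrow> real"
  where "sup_norm a = (if bounded (range a) then SUP n. norm (a n) else 0)"

definition lp_topology :: "real \<Rightarrow> (nat \<Rightarrow> 'k::real_normed_vector) topology"
  where "lp_topology r = Metric_space.mtopology (lp r) (\<lambda>a b. lp_norm r (\<lambda>n. a n - b n))"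

definition c0_topology :: "(nat \<Rightarrow> 'k::real_normed_vector) topology"
  where "c0_topology = Metric_space.mtopology c0 (\<lambda>a b. sup_norm (\<lambda>n. a n - b n))"

definition seq_scale :: "'k::real_normed_field \<Rightarrow> (nat \<Rightarrow> 'k) \<Rightarrow> (nat \<Rightarrow> 'k)"
  where "seq_scale c a = (\<lambda>n. c * a n)"

definition unit_vector :: "nat \<Rightarrow> nat \<Rightarrow> 'k::real_normed_field"
  where "unit_vector n = (\<lambda>k. if k = n then 1 else 0)"

definition unit_vector_span :: "(nat \<Rightarrow> 'k::real_normed_field) set"
  where "unit_vector_span = module.span seq_scale (range unit_vector)"

definition lp0_topology :: "real \<Rightarrow> (nat \<Rightarrow> 'k::real_normed_field) topology"
  where "lp0_topology r = subtopology (lp_topology r) unit_vector_span"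

definition c00_topology :: "(nat \<Rightarrow> 'k::real_normed_field) topology"
  where "c00_topology = subtopology c0_topology unit_vector_span"

definition conjugate_exponent :: "real \<Rightarrow> real"
  where "conjugate_exponent p = p / (p - 1)"

lemma conjugate_exponent:
  assumes "1 < p"
  shows "1 / p + 1 / conjugate_exponent p = 1" and "1 < conjugate_exponent p"
  using assms by (auto simp: conjugate_exponent_def field_simps)


lemma lp_norm_nonneg: "0 \<le> lp_norm r a"
  by (simp add: lp_norm_def)

lemma lp_norm_powr:
  assumes "0 < r" "a \<in> lp r"
  shows "lp_norm r a powr r = (\<Sum>n. norm (a n) powr r)"
  using assms by (simp add: lp_norm_def lp_def powr_powr suminf_nonneg)

lemma lp_norm_eq_0_iff:
  assumes "0 < r" "a \<in> lp r"
  shows "lp_norm r a = 0 \<longleftrightarrow> (\<forall>n. a n = 0)"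
  using assms by (simp add: lp_norm_def lp_def suminf_eq_zero_iff)

lemma lp_norm_minus_commute: "lp_norm r (\<lambda>n. a n - b n) = lp_norm r (\<lambda>n. b n - a n)"
  by (simp add: lp_norm_def norm_minus_commute)

lemma lp_uminus: "a \<in> lp r \<Longrightarrow> (\<lambda>n. - a n) \<in> lp r"
  by (simp add: lp_def)

lemma powr_convex_combination:
  fixes u v s t r :: real
  assumes "1 \<le> r" "0 \<le> u" "0 \<le> v" "0 < s" "0 < t" "s + t = 1"
  shows "(s * u + t * v) powr r \<le> s * u powr r + t * v powr r"
proof (cases "u = 0 \<or> v = 0")
  case False
  have "convex_on {0<..} (\<lambda>x. x powr r)"
    using assms by (simp add: powr_convex)
  from convex_onD[OF this, of t u v] False assms show ?thesis
    by (simp add: algebra_simps flip: eq_diff_eq)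
next
  case True
  have *: "w powr r \<le> w" if "0 < w" "w \<le> 1" for w :: real
    using powr_mono'[of 1 r w] that assms by simp
  from True show ?thesis
  proof
    assume "u = 0"
    then show ?thesis using assms *[of t] by (simp add: powr_mult mult_right_mono)
  next
    assume "v = 0"
    then show ?thesis using assms *[of s] by (simp add: powr_mult mult_right_mono)
  qed
qed

lemma lp_add:
  fixes a b :: "nat \<Rightarrow> 'k::real_normed_vector"
  assumes r: "1 \<le> r" and a: "a \<in> lp r" and b: "b \<in> lp r"
  shows lp_add_closed: "(\<lambda>n. a n + b n) \<in> lp r"
    and lp_norm_triangle: "lp_norm r (\<lambda>n. a n + b n) \<le> lp_norm r a + lp_norm r b"
proof -
  have "(\<lambda>n. a n + b n) \<in> lp r \<and> lp_norm r (\<lambda>n. a n + b n) \<le> lp_norm r a + lp_norm r b"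
  proof (cases "lp_norm r a = 0 \<or> lp_norm r b = 0")
    case True
    then have "(\<forall>n. a n = 0) \<or> (\<forall>n. b n = 0)"
      using lp_norm_eq_0_iff[of r a] lp_norm_eq_0_iff[of r b] a b r by auto
    then show ?thesis using a b by (auto simp: lp_norm_nonneg)
  next
    case False
    define A B where "A = lp_norm r a" and "B = lp_norm r b"
    have pos: "0 < A" "0 < B"
      using False lp_norm_nonneg[of r a] lp_norm_nonneg[of r b] by (auto simp: A_def B_def)
    define s t where "s = A / (A + B)" and "t = B / (A + B)"
    have st: "0 < s" "0 < t" "s + t = 1"
      using pos by (auto simp: s_def t_def simp flip: add_divide_distrib)
    have st_mult: "(A + B) * s = A" "(A + B) * t = B"
      using pos by (auto simp: s_def t_def)
    define g where "g n = (A + B) powr r *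
        (s * (norm (a n) powr r / A powr r) + t * (norm (b n) powr r / B powr r))" for n
    have sa: "(\<lambda>n. norm (a n) powr r) sums (A powr r)"
      using a lp_norm_powr[OF _ a] r by (simp add: A_def lp_def summable_sums)
    have sb: "(\<lambda>n. norm (b n) powr r) sums (B powr r)"
      using b lp_norm_powr[OF _ b] r by (simp add: B_def lp_def summable_sums)
    have "g sums ((A + B) powr r * (s * (A powr r / A powr r) + t * (B powr r / B powr r)))"
      unfolding g_def by (intro sums_mult sums_add sums_divide sa sb)
    then have sg: "g sums ((A + B) powr r)"
      using pos st by simp
    have le: "norm (a n + b n) powr r \<le> g n" for n
    proof -
      have "norm (a n + b n) \<le> (A + B) * (s * (norm (a n) / A) + t * (norm (b n) / B))"
        using norm_triangle_ineq[of "a n" "b n"] pos st_mult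
        by (simp add: distrib_left flip: mult.assoc)
      then have "norm (a n + b n) powr r
          \<le> ((A + B) * (s * (norm (a n) / A) + t * (norm (b n) / B))) powr r"
        using r by (intro powr_mono2) auto
      also have "\<dots> = (A + B) powr r * (s * (norm (a n) / A) + t * (norm (b n) / B)) powr r"
        using pos st by (intro powr_mult)
      also have "\<dots> \<le> (A + B) powr r *
          (s * (norm (a n) / A) powr r + t * (norm (b n) / B) powr r)"
        using pos st r by (intro mult_left_mono powr_convex_combination) auto
      also have "\<dots> = g n"
        using pos by (simp add: g_def powr_divide)
      finally show ?thesis .
    qed
    have sum: "summable (\<lambda>n. norm (a n + b n) powr r)"
      by (rule summable_comparison_test[OF _ sums_summable[OF sg]]) (use le in auto)
    have "(\<Sum>n. norm (a n + b n) powr r) \<le> (A + B) powr r"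
      using suminf_le[OF le sum sums_summable[OF sg]] sums_unique[OF sg] by simp
    then have "lp_norm r (\<lambda>n. a n + b n) \<le> ((A + B) powr r) powr (1 / r)"
      unfolding lp_norm_def using r sum by (intro powr_mono2 suminf_nonneg) auto
    also have "\<dots> = A + B"
      using r pos by (simp add: powr_powr)
    finally show ?thesis
      using sum by (simp add: lp_def A_def B_def)
  qed
  then show "(\<lambda>n. a n + b n) \<in> lp r"
    and "lp_norm r (\<lambda>n. a n + b n) \<le> lp_norm r a + lp_norm r b" by auto
qed

lemma Metric_space_lp:
  assumes r: "1 \<le> r"
  shows "Metric_space (lp r) (\<lambda>a b :: nat \<Rightarrow> 'k::real_normed_vector. lp_norm r (\<lambda>n. a n - b n))"
proof
  have diff: "(\<lambda>n. a n - b n) \<in> lp r" if "a \<in> lp r" "b \<in> lp r" for a b :: "nat \<Rightarrow> 'k"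
    using lp_add_closed[OF r that(1) lp_uminus[OF that(2)]] by simp
  fix a b c :: "nat \<Rightarrow> 'k"
  show "0 \<le> lp_norm r (\<lambda>n. a n - b n)" by (rule lp_norm_nonneg)
  show "lp_norm r (\<lambda>n. a n - b n) = lp_norm r (\<lambda>n. b n - a n)"
    by (rule lp_norm_minus_commute)
  show "lp_norm r (\<lambda>n. a n - b n) = 0 \<longleftrightarrow> a = b" if "a \<in> lp r" "b \<in> lp r"
    using lp_norm_eq_0_iff[OF _ diff[OF that]] r by (auto simp: fun_eq_iff)
  show "lp_norm r (\<lambda>n. a n - c n) \<le> lp_norm r (\<lambda>n. a n - b n) + lp_norm r (\<lambda>n. b n - c n)"
    if "a \<in> lp r" "b \<in> lp r" "c \<in> lp r"
    using lp_norm_triangle[OF r diff[OF that(1,2)] diff[OF that(2,3)]] by simp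
qed

lemma Metric_space_c0:
  "Metric_space c0 (\<lambda>a b :: nat \<Rightarrow> 'k::real_normed_vector. sup_norm (\<lambda>n. a n - b n))"
proof
  have diff: "(\<lambda>n. a n - b n) \<in> c0" if "a \<in> c0" "b \<in> c0" for a b :: "nat \<Rightarrow> 'k"
    using that tendsto_diff[of a 0 sequentially b 0] by (simp add: c0_def)
  have bounded: "bounded (range a)" if "a \<in> c0" for a :: "nat \<Rightarrow> 'k"
    using that by (auto simp: c0_def intro: convergent_imp_bounded)
  have bdd: "bdd_above (range (\<lambda>n. norm (a n)))" if "bounded (range a)" for a :: "nat \<Rightarrow> 'k"
    using that by (auto simp: bounded_iff intro: bdd_aboveI2)
  have upper: "norm (a n) \<le> sup_norm a" if "bounded (range a)" for a :: "nat \<Rightarrow> 'k" and n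
    using that by (auto simp: sup_norm_def intro: cSUP_upper[OF UNIV_I bdd])
  have nonneg: "0 \<le> sup_norm a" for a :: "nat \<Rightarrow> 'k"
    using upper[of a 0] order_trans[OF norm_ge_zero] by (cases "bounded (range a)") (auto simp: sup_norm_def)
  have sup_comm: "sup_norm (\<lambda>n. a n - b n) = sup_norm (\<lambda>n. b n - a n)" for a b :: "nat \<Rightarrow> 'k"
  proof -
    have "norm (a n - b n) = norm (b n - a n)" for n by (rule norm_minus_commute)
    moreover from this have "bounded (range (\<lambda>n. a n - b n)) = bounded (range (\<lambda>n. b n - a n))"
      unfolding bounded_iff by simp
    ultimately show ?thesis by (simp add: sup_norm_def)
  qed
  fix a b c :: "nat \<Rightarrow> 'k"
  show "0 \<le> sup_norm (\<lambda>n. a n - b n)" by (rule nonneg)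
  show "sup_norm (\<lambda>n. a n - b n) = sup_norm (\<lambda>n. b n - a n)" by (rule sup_comm)
  show "sup_norm (\<lambda>n. a n - b n) = 0 \<longleftrightarrow> a = b" if "a \<in> c0" "b \<in> c0"
  proof
    assume "sup_norm (\<lambda>n. a n - b n) = 0"
    then show "a = b" using upper[OF bounded[OF diff[OF that]]] by (auto simp: fun_eq_iff)
  qed (simp add: sup_norm_def)
  show "sup_norm (\<lambda>n. a n - c n) \<le> sup_norm (\<lambda>n. a n - b n) + sup_norm (\<lambda>n. b n - c n)"
    if "a \<in> c0" "b \<in> c0" "c \<in> c0"
  proof -
    have *: "norm (a n - c n) \<le> sup_norm (\<lambda>n. a n - b n) + sup_norm (\<lambda>n. b n - c n)" for n
      using upper[OF bounded[OF diff[OF that(1,2)]], of n] upper[OF bounded[OF diff[OF that(2,3)]], of n]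
        norm_triangle_ineq[of "a n - b n" "b n - c n"] by simp
    have "(SUP n. norm (a n - c n)) \<le> sup_norm (\<lambda>n. a n - b n) + sup_norm (\<lambda>n. b n - c n)"
      by (rule cSUP_least) (simp_all add: *)
    then show ?thesis
      using bounded[OF diff[OF that(1,3)]] by (simp add: sup_norm_def[of "\<lambda>n. a n - c n"])
  qed
qed


section \<open>Operators\<close>

text \<open>
  The domain of an operator is the carrier of a topology on a function type, so the values of
  the underlying HOL function outside that carrier are irrelevant.
\<close>

definition operator_on ::
  "'y::ab_group_add topology \<Rightarrow> ('k \<Rightarrow> 'y \<Rightarrow> 'y) \<Rightarrow>
    ('k \<Rightarrow> 'e::{topological_space, ab_group_add} \<Rightarrow> 'e) \<Rightarrow> ('y \<Rightarrow> 'e) \<Rightarrow> bool"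
  where "operator_on Y smulY smulE S \<longleftrightarrow>
    (\<forall>a\<in>topspace Y. \<forall>b\<in>topspace Y. S (a + b) = S a + S b) \<and>
    (\<forall>c. \<forall>a\<in>topspace Y. S (smulY c a) = smulE c (S a)) \<and>
    continuous_map Y euclidean S"

definition zero_neighborhood :: "'y::zero topology \<Rightarrow> 'y set \<Rightarrow> bool"
  where "zero_neighborhood Y U \<longleftrightarrow> U \<subseteq> topspace Y \<and> (\<exists>V. openin Y V \<and> 0 \<in> V \<and> V \<subseteq> U)"

definition sequentially_precompact_operator ::
  "'y::zero topology \<Rightarrow> ('y \<Rightarrow> 'e::uniform_space) \<Rightarrow> bool"
  where "sequentially_precompact_operator Y S \<longleftrightarrow>
    (\<exists>U. zero_neighborhood Y U \<and> sequentially_precompact (S ` U))"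

definition sequentially_compact_operator ::
  "'y::zero topology \<Rightarrow> ('y \<Rightarrow> 'e::topological_space) \<Rightarrow> bool"
  where "sequentially_compact_operator Y S \<longleftrightarrow>
    (\<exists>U. zero_neighborhood Y U \<and> relatively_sequentially_compact (S ` U))"


section \<open>Weak $p$-summability\<close>

definition weakly_p_summable ::
  "real \<Rightarrow> ('k::real_or_complex_field \<Rightarrow> 'e::{topological_space, ab_group_add} \<Rightarrow> 'e) \<Rightarrow>
    (nat \<Rightarrow> 'e) \<Rightarrow> bool"
  where "weakly_p_summable p smul x \<longleftrightarrow> (\<forall>f\<in>continuous_dual smul. (\<lambda>n. f (x n)) \<in> lp p)"

definition weakly_p_convergent_to ::
  "real \<Rightarrow> ('k::real_or_complex_field \<Rightarrow> 'e::{topological_space, ab_group_add} \<Rightarrow> 'e) \<Rightarrow>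
    (nat \<Rightarrow> 'e) \<Rightarrow> 'e \<Rightarrow> bool"
  where "weakly_p_convergent_to p smul x l \<longleftrightarrow> weakly_p_summable p smul (\<lambda>n. x n - l)"

definition weakly_p_Cauchy ::
  "real \<Rightarrow> ('k::real_or_complex_field \<Rightarrow> 'e::{topological_space, ab_group_add} \<Rightarrow> 'e) \<Rightarrow>
    (nat \<Rightarrow> 'e) \<Rightarrow> bool"
  where "weakly_p_Cauchy p smul x \<longleftrightarrow>
    (\<forall>k j :: nat \<Rightarrow> nat. strict_mono k \<and> strict_mono j \<longrightarrow>
      weakly_p_summable p smul (\<lambda>n. x (k n) - x (j n)))"

definition weakly_sequentially_p_complete ::
  "real \<Rightarrow> ('k::real_or_complex_field \<Rightarrow> 'e::{topological_space, ab_group_add} \<Rightarrow> 'e) \<Rightarrow> bool"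
  where "weakly_sequentially_p_complete p smul \<longleftrightarrow>
    (\<forall>x. weakly_p_Cauchy p smul x \<longrightarrow> (\<exists>l. weakly_p_convergent_to p smul x l))"

definition p_convergent_map ::
  "real \<Rightarrow> ('k::real_or_complex_field \<Rightarrow> 'e::{topological_space, ab_group_add} \<Rightarrow> 'e) \<Rightarrow>
    ('k \<Rightarrow> 'f::{topological_space, ab_group_add} \<Rightarrow> 'f) \<Rightarrow> ('e \<Rightarrow> 'f) \<Rightarrow> bool"
  where "p_convergent_map p smulE smulF T \<longleftrightarrow>
    Vector_Spaces.linear smulE smulF T \<and>
    (\<forall>x. weakly_p_summable p smulE x \<longrightarrow> (\<lambda>n. T (x n)) \<longlonglongrightarrow> 0)"

definition p_Schur_property ::
  "real \<Rightarrow> ('k::real_or_complex_field \<Rightarrow> 'e::{topological_space, ab_group_add} \<Rightarrow> 'e) \<Rightarrow> bool"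
  where "p_Schur_property p smul \<longleftrightarrow> (\<forall>x. weakly_p_summable p smul x \<longrightarrow> x \<longlonglongrightarrow> 0)"

end

theory Submission
  imports Defs "HOL-Complex_Analysis.Great_Picard"
begin

text \<open>
  Write \<open>X\<close> for \<open>lp q\<close> with \<open>q\<close> conjugate to \<open>p > 1\<close>, or for \<open>c0\<close> if \<open>p = 1\<close>, and \<open>Y\<close> for \<open>X\<close>
  or its subspace of finitely supported sequences. An operator \<open>S\<close> on \<open>Y\<close> is determined by its
  values \<open>x n\<close> at the unit vectors, and because the dual of \<open>Y\<close> is \<open>lp p\<close>, those values are
  always weakly \<open>p\<close>-summable. So the theorem compares a property of weakly \<open>p\<close>-summable
  sequences with a property of the operators that they generate.

  From the Schur property to precompactness: the unit ball of \<open>Y\<close> is coordinatewise precompact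
  by a diagonal argument, so it suffices that \<open>S\<close> maps bounded coordinatewise null sequences
  close to zero (\<open>Schur_operator_meets_neighborhood\<close>). A gliding hump replaces such a sequence,
  up to a norm-null error, by blocks with disjoint supports. By Hoelder's inequality on each
  block, the images of the blocks are again weakly \<open>p\<close>-summable, hence null. Since \<open>E\<close> may
  fail to be metrizable, the subsequence is chosen by the coordinates alone and one neighborhood of
  zero is treated at a time. The axioms of \<open>normed_sequence_space\<close> cover \<open>lp q\<close> and \<open>c0\<close>, and
  the full spaces and their finitely supported parts, at once.

  From precompactness to the Schur property: a weakly \<open>p\<close>-summable sequence \<open>x\<close> generates the
  operator \<open>a \<mapsto> \<Sum>n. a n * x n\<close>. The partial sums over the unit ball of \<open>Y\<close> are weakly bounded by
  Hoelder's inequality, so they are bounded by Mackey's theorem (\<open>weakly_bounded_imp_bounded\<close>);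
  this gives continuity, and convergence of the series if \<open>E\<close> is sequentially complete or the
  sequences are finitely supported. Precompactness then yields Cauchy subsequences of \<open>x\<close>, and a
  weakly null Cauchy sequence is null (\<open>weakly_null_Cauchy_imp_null\<close>).

  If \<open>E\<close> is sequentially complete, Cauchy and convergent sequences are the same, which turns
  precompactness into compactness.

  The duality theory of \<open>E\<close> rests on the Hahn-Banach theorem. It is proved and used for real
  functionals; these are only converted to functionals over the scalar field, which may be
  the reals or the complex numbers, by the domination lemma \<open>real_dual_dominated\<close>.
\<close>

section \<open>Sublinear functionals and the Hahn-Banach theorem\<close>

definition sublinear :: "(real \<Rightarrow> 'v::ab_group_add \<Rightarrow> 'v) \<Rightarrow> ('v \<Rightarrow> real) \<Rightarrow> bool"
  where "sublinear sc q \<longleftrightarrow>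
    (\<forall>x y. q (x + y) \<le> q x + q y) \<and> (\<forall>r x. 0 < r \<longrightarrow> q (sc r x) = r * q x)"

lemma sublinearI:
  fixes sc :: "real \<Rightarrow> 'v::ab_group_add \<Rightarrow> 'v"
  assumes "vector_space sc"
    and add: "\<And>x y. q (x + y) \<le> q x + q y"
    and scale: "\<And>r x. 0 < r \<Longrightarrow> q (sc r x) \<le> r * q x"
  shows "sublinear sc q"
proof -
  interpret vector_space sc by fact
  have "q (sc r x) = r * q x" if r: "0 < r" for r x
  proof (rule antisym[OF scale[OF r]])
    have "q x = q (sc (inverse r) (sc r x))"
      using r by simp
    also have "\<dots> \<le> inverse r * q (sc r x)"
      using r by (intro scale) auto
    finally show "r * q x \<le> q (sc r x)"
      using r by (simp add: field_simps)
  qed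
  then show ?thesis using add by (simp add: sublinear_def)
qed

context
  fixes sc :: "real \<Rightarrow> 'v::ab_group_add \<Rightarrow> 'v"
  assumes vs: "vector_space sc"
begin

interpretation vector_space sc by (fact vs)

lemma sublinear_0:
  assumes "sublinear sc q" shows "q 0 = 0"
  using assms[unfolded sublinear_def, THEN conjunct2, rule_format, of 2 0] by simp

lemma sublinear_scale:
  assumes "sublinear sc q" "0 \<le> r" shows "q (sc r x) = r * q x"
  using assms sublinear_0[OF assms(1)] by (cases "r = 0") (auto simp: sublinear_def)

lemma sublinear_minus:
  assumes "sublinear sc q" shows "- q (- x) \<le> q x"
proof -
  have "q (x + - x) \<le> q x + q (- x)"
    using assms unfolding sublinear_def by blast
  then show ?thesis using sublinear_0[OF assms] by simp
qed

text \<open>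
  The infimum of \<open>q (x + t y) - t q y\<close> over \<open>t \<ge> 0\<close> is the largest sublinear functional below \<open>q\<close>
  with a value of at most \<open>- q y\<close> at \<open>- y\<close>. Applied to a minimal functional it shows additivity;
  applied to the given \<open>q\<close> beforehand it makes the eventual linear functional attain \<open>q y\<close>.
\<close>

lemma sublinear_shrink:
  assumes q: "sublinear sc q"
  shows "\<exists>q'. sublinear sc q' \<and> (\<forall>x. q' x \<le> q x) \<and> q' (- y) \<le> - q y"
proof -
  have add: "q (a + b) \<le> q a + q b" for a b
    using q by (auto simp: sublinear_def)
  define h where "h x t = q (x + sc t y) - t * q y" for x t
  define q' where "q' x = (INF t\<in>{0..}. h x t)" for x
  have low: "- q (- x) \<le> h x t" if "0 \<le> t" for x t
    using add[of "x + sc t y" "- x"] sublinear_scale[OF q that, of y] by (simp add: h_def)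
  have bdd: "bdd_below (h x ` {0..})" for x
    using low by (intro bdd_belowI2[where m = "- q (- x)"]) auto
  have le: "q' x \<le> h x t" if "0 \<le> t" for x t
    unfolding q'_def using that by (intro cINF_lower bdd) auto
  have geI: "c \<le> q' x" if "\<And>t. 0 \<le> t \<Longrightarrow> c \<le> h x t" for c x
    unfolding q'_def using that by (intro cINF_greatest) auto
  have "sublinear sc q'"
  proof (rule sublinearI[OF vs])
    fix x z
    have *: "q' (x + z) \<le> h x t + h z s" if "0 \<le> t" "0 \<le> s" for t s
    proof -
      have "q' (x + z) \<le> h (x + z) (t + s)"
        using that by (intro le) auto
      also have "\<dots> \<le> h x t + h z s"
        using add[of "x + sc t y" "z + sc s y"]
        by (simp add: h_def algebra_simps scale_left_distrib)
      finally show ?thesis .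
    qed
    have "q' (x + z) - h z s \<le> q' x" if "0 \<le> s" for s
      using *[OF _ that] by (intro geI) (auto simp: algebra_simps)
    then have "q' (x + z) - q' x \<le> q' z"
      by (intro geI) (auto simp: algebra_simps)
    then show "q' (x + z) \<le> q' x + q' z" by simp
  next
    fix r :: real and x assume r: "0 < r"
    have "q' (sc r x) / r \<le> h x t" if "0 \<le> t" for t
    proof -
      have "q' (sc r x) \<le> h (sc r x) (r * t)"
        using r that by (intro le) auto
      also have "\<dots> = r * h x t"
        using sublinear_scale[OF q, of r "x + sc t y"] r
        by (simp add: h_def scale_right_distrib algebra_simps)
      finally show ?thesis using r by (simp add: field_simps)
    qed
    then have "q' (sc r x) / r \<le> q' x" by (intro geI)
    then show "q' (sc r x) \<le> r * q' x" using r by (simp add: field_simps)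
  qed
  moreover have "q' x \<le> q x" for x
    using le[of 0 x] by (simp add: h_def)
  moreover have "q' (- y) \<le> - q y"
    using le[of 1 "- y"] sublinear_0[OF q] by (simp add: h_def)
  ultimately show ?thesis by blast
qed

text \<open>
  Zorn's lemma applies because every sublinear \<open>m \<le> q\<close> satisfies \<open>- q (- x) \<le> m x\<close>, so that the pointwise
  infimum of a chain is finite; the chain property makes that infimum subadditive.
\<close>

lemma exists_minimal_sublinear:
  assumes q: "sublinear sc q"
  shows "\<exists>m. sublinear sc m \<and> (\<forall>x. m x \<le> q x) \<and>
    (\<forall>m'. sublinear sc m' \<longrightarrow> (\<forall>x. m' x \<le> m x) \<longrightarrow> m' = m)"
proof -
  define A where "A = {m. sublinear sc m \<and> (\<forall>x. m x \<le> q x)}"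
  define P where "P f g \<longleftrightarrow> (\<forall>x. g x \<le> f x)" for f g :: "'v \<Rightarrow> real"
  have "\<exists>m\<in>A. \<forall>a\<in>A. P m a \<longrightarrow> a = m"
  proof (rule predicate_Zorn)
    show "partial_order_on A (relation_of P A)"
      by (rule partial_order_on_relation_ofI) (auto simp: P_def fun_eq_iff intro: order_trans antisym)
  next
    fix C assume C: "C \<in> Chains (relation_of P A)"
    have CA: "C \<subseteq> A" and chain: "\<And>f g. f \<in> C \<Longrightarrow> g \<in> C \<Longrightarrow> P f g \<or> P g f"
      using C by (auto simp: Chains_def relation_of_def)
    show "\<exists>u\<in>A. \<forall>a\<in>C. P a u"
    proof (cases "C = {}")
      case True
      then show ?thesis using q by (auto simp: A_def)
    next
      case False
      define u where "u x = (INF m\<in>C. m x)" for x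
      have low: "- q (- x) \<le> m x" if "m \<in> C" for m x
      proof -
        have "sublinear sc m" "m (- x) \<le> q (- x)"
          using that CA by (auto simp: A_def)
        then show ?thesis using sublinear_minus[of m x] by simp
      qed
      have le: "u x \<le> m x" if "m \<in> C" for m x
        unfolding u_def using that low
        by (intro cINF_lower bdd_belowI2[where m = "- q (- x)"]) auto
      have geI: "c \<le> u x" if "\<And>m. m \<in> C \<Longrightarrow> c \<le> m x" for c x
        unfolding u_def using that False by (intro cINF_greatest) auto
      have "sublinear sc u"
      proof (rule sublinearI[OF vs])
        fix x z
        have *: "u (x + z) \<le> m x + n z" if mn: "m \<in> C" "n \<in> C" for m n
        proof -
          obtain k where k: "k \<in> C" "k x \<le> m x" "k z \<le> n z"
            using chain[OF mn] mn unfolding P_def by blast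
          have "u (x + z) \<le> k (x + z)" using k by (intro le)
          also have "\<dots> \<le> k x + k z"
            using k CA by (auto simp: A_def sublinear_def)
          finally show ?thesis using k by simp
        qed
        have "u (x + z) - n z \<le> u x" if "n \<in> C" for n
          using *[OF _ that] by (intro geI) (auto simp: algebra_simps)
        then have "u (x + z) - u x \<le> u z"
          by (intro geI) (auto simp: algebra_simps)
        then show "u (x + z) \<le> u x + u z" by simp
      next
        fix r :: real and x assume r: "0 < r"
        have "u (sc r x) / r \<le> m x" if "m \<in> C" for m
        proof -
          have "u (sc r x) \<le> m (sc r x)" by (intro le that)
          also have "\<dots> = r * m x"
            using that CA r by (auto simp: A_def sublinear_def)
          finally show ?thesis using r by (simp add: field_simps)
        qed
        then have "u (sc r x) / r \<le> u x" by (intro geI)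
        then show "u (sc r x) \<le> r * u x" using r by (simp add: field_simps)
      qed
      moreover have "u x \<le> q x" for x
      proof -
        obtain m where "m \<in> C" using False by blast
        then have "u x \<le> m x" "m x \<le> q x" using CA by (auto simp: A_def intro: le)
        then show ?thesis by simp
      qed
      ultimately show ?thesis
        using le by (intro bexI[of _ u]) (auto simp: A_def P_def)
    qed
  qed
  then obtain m where m: "m \<in> A" "\<And>a. a \<in> A \<Longrightarrow> P m a \<Longrightarrow> a = m" by blast
  show ?thesis
  proof (intro exI conjI allI impI)
    show "sublinear sc m" "\<And>x. m x \<le> q x" using m(1) by (auto simp: A_def)
    fix m' assume "sublinear sc m'" "\<forall>x. m' x \<le> m x"
    with m(1) show "m' = m"
      by (intro m(2)) (auto simp: A_def P_def intro: order_trans)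
  qed
qed

text \<open>
  Hahn-Banach without extending from subspaces: a minimal sublinear functional is linear, since
  \<open>sublinear_shrink\<close> cannot decrease it in any direction.
\<close>

lemma sublinear_dominates_linear:
  assumes q: "sublinear sc q"
  shows "\<exists>f. Vector_Spaces.linear sc (*) f \<and> (\<forall>x. f x \<le> q x) \<and> f y = q y"
proof -
  obtain q' where q': "sublinear sc q'" "\<And>x. q' x \<le> q x" "q' (- y) \<le> - q y"
    using sublinear_shrink[OF q] by blast
  obtain f where f: "sublinear sc f" "\<And>x. f x \<le> q' x"
    and min: "\<And>f'. sublinear sc f' \<Longrightarrow> (\<forall>x. f' x \<le> f x) \<Longrightarrow> f' = f"
    using exists_minimal_sublinear[OF q'(1)] by blast
  have add_le: "f (x + z) \<le> f x + f z" for x z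
    using f(1) by (auto simp: sublinear_def)
  have neg: "f (- x) = - f x" for x
  proof (rule antisym)
    obtain f' where f': "sublinear sc f'" "\<forall>x. f' x \<le> f x" "f' (- x) \<le> - f x"
      using sublinear_shrink[OF f(1)] by blast
    moreover have "f' = f" using f' by (intro min)
    ultimately show "f (- x) \<le> - f x" by simp
    show "- f x \<le> f (- x)" using sublinear_minus[OF f(1), of "- x"] by simp
  qed
  have add: "f (x + z) = f x + f z" for x z
    using add_le[of x z] add_le[of "x + z" "- z"] neg[of z] by simp
  have scale: "f (sc r x) = r * f x" for r x
  proof (cases "0 \<le> r")
    case True
    then show ?thesis by (rule sublinear_scale[OF f(1)])
  next
    case False
    then have "f (sc (- r) x) = - r * f x" by (intro sublinear_scale[OF f(1)]) simp
    then show ?thesis using neg[of "sc r x"] by simp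
  qed
  have "Vector_Spaces.linear sc (*) f"
    unfolding Vector_Spaces.linear_iff
    using vs add scale by (simp add: vector_space_over_itself.vector_space_axioms)
  moreover have "f x \<le> q x" for x using f(2)[of x] q'(2)[of x] by simp
  moreover have "f y = q y"
    using f(2)[of "- y"] q'(3) neg[of y] calculation(2)[of y] by simp
  ultimately show ?thesis by blast
qed

end

section \<open>The scalar field\<close>

text \<open>
  Both alternatives for the scalar field are viewed inside the complex numbers, so that coordinate
  arguments need no case distinction. An additive, multiplicative isometry has to fix the
  real numbers.
\<close>

lemma real_or_complex_field_embedding:
  obtains \<psi> :: "'k::real_or_complex_field \<Rightarrow> complex"
  where "\<And>x y. \<psi> (x + y) = \<psi> x + \<psi> y" "\<And>x y. \<psi> (x * y) = \<psi> x * \<psi> y"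
    "\<And>x. norm (\<psi> x) = norm x" "\<And>r. \<psi> (of_real r) = of_real r"
    "range \<psi> = \<real> \<or> range \<psi> = UNIV"
proof -
  have "\<exists>\<psi>::'k \<Rightarrow> complex. (\<forall>x y. \<psi> (x + y) = \<psi> x + \<psi> y) \<and> (\<forall>x y. \<psi> (x * y) = \<psi> x * \<psi> y)
     \<and> (\<forall>x. norm (\<psi> x) = norm x) \<and> (range \<psi> = \<real> \<or> range \<psi> = UNIV)"
    using real_or_complex[where 'a = 'k]
  proof (elim disjE exE conjE)
    fix \<phi> :: "'k \<Rightarrow> real"
    assume *: "bij \<phi>" "\<forall>x y. \<phi> (x + y) = \<phi> x + \<phi> y" "\<forall>x y. \<phi> (x * y) = \<phi> x * \<phi> y"
      "\<forall>x. norm (\<phi> x) = norm x"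
    have "range (\<lambda>x. complex_of_real (\<phi> x)) = of_real ` range \<phi>" by (simp add: image_image)
    then have "range (\<lambda>x. complex_of_real (\<phi> x)) = \<real>"
      using * by (simp add: bij_def Reals_def)
    then show ?thesis using *
      by (intro exI[of _ "\<lambda>x. complex_of_real (\<phi> x)"]) auto
  next
    fix \<phi> :: "'k \<Rightarrow> complex"
    assume *: "bij \<phi>" "\<forall>x y. \<phi> (x + y) = \<phi> x + \<phi> y" "\<forall>x y. \<phi> (x * y) = \<phi> x * \<phi> y"
      "\<forall>x. norm (\<phi> x) = norm x"
    then show ?thesis
      by (intro exI[of _ \<phi>]) (auto simp: bij_def)
  qed
  then obtain \<psi> :: "'k \<Rightarrow> complex" where
    add: "\<And>x y. \<psi> (x + y) = \<psi> x + \<psi> y" and mult: "\<And>x y. \<psi> (x * y) = \<psi> x * \<psi> y"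
    and norm: "\<And>x. norm (\<psi> x) = norm x" and range: "range \<psi> = \<real> \<or> range \<psi> = UNIV"
    by blast
  have diff: "\<psi> (x - y) = \<psi> x - \<psi> y" for x y
    using add[of "x - y" y] by simp
  have "\<psi> 1 * \<psi> 1 = \<psi> 1" using mult[of 1 1] by simp
  moreover have "\<psi> 1 \<noteq> 0" using norm[of 1] by auto
  ultimately have one: "\<psi> 1 = 1" by simp
  have "\<psi> (of_real r) = of_real r" for r
  proof -
    \<comment> \<open>A complex number equals the real number \<open>r\<close> once it has the same distances to 0 and 1.\<close>
    let ?z = "\<psi> (of_real r)"
    have "(cmod ?z)\<^sup>2 = r\<^sup>2" using norm[of "of_real r"] by simp
    moreover have "(cmod (?z - 1))\<^sup>2 = (r - 1)\<^sup>2"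
    proof -
      have "cmod (?z - 1) = cmod (\<psi> (of_real r - 1))" by (simp add: diff one)
      also have "\<dots> = norm (of_real (r - 1) :: 'k)" by (simp only: norm of_real_diff of_real_1)
      finally show ?thesis by (simp only: norm_of_real power2_abs)
    qed
    ultimately have "(Re ?z)\<^sup>2 + (Im ?z)\<^sup>2 = r\<^sup>2" "(Re ?z - 1)\<^sup>2 + (Im ?z)\<^sup>2 = (r - 1)\<^sup>2"
      by (simp_all add: cmod_power2)
    moreover from this have "Re ?z = r" by (simp add: power2_diff)
    ultimately have "Re ?z = r" "Im ?z = 0" by simp_all
    then show ?thesis by (simp add: complex_eq_iff)
  qed
  from that[OF add mult norm this range] show thesis .
qed

text \<open>
  The diagonal argument takes place in the complex numbers, where bounded closed sets are compact,
  and is transported back along the isometric embedding.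
\<close>

lemma bounded_sequence_coordinatewise_Cauchy:
  fixes a :: "nat \<Rightarrow> nat \<Rightarrow> 'k::real_or_complex_field"
  assumes "\<And>i n. norm (a i n) \<le> M"
  obtains r where "strict_mono (r :: nat \<Rightarrow> nat)" "\<And>n. Cauchy (\<lambda>i. a (r i) n)"
proof -
  obtain \<psi> :: "'k \<Rightarrow> complex" where
    \<psi>: "\<And>x y. \<psi> (x + y) = \<psi> x + \<psi> y" "\<And>x. norm (\<psi> x) = norm x"
    using real_or_complex_field_embedding by metis
  have dist: "dist (\<psi> x) (\<psi> y) = dist x y" for x y
    using \<psi>(1)[of "x - y" y] \<psi>(2)[of "x - y"] by (simp add: dist_norm)
  obtain r where r: "strict_mono (r :: nat \<Rightarrow> nat)"
    "\<And>n. n \<in> UNIV \<Longrightarrow> \<exists>l. (\<lambda>i. \<psi> (a (r i) n)) \<longlonglongrightarrow> l"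
    by (rule function_convergent_subsequence[of UNIV "\<lambda>i n. \<psi> (a i n)" M]) (auto simp: \<psi>(2) assms)
  have "Cauchy (\<lambda>i. a (r i) n)" for n
  proof -
    have "Cauchy (\<lambda>i. \<psi> (a (r i) n))" using r(2)[of n] by (auto intro: LIMSEQ_imp_Cauchy)
    then show ?thesis by (simp add: Cauchy_def dist)
  qed
  with r(1) that show thesis by blast
qed

section \<open>Seminorms and functionals on a locally convex space\<close>

context locally_convex_space
begin

abbreviation rscale :: "real \<Rightarrow> 'e \<Rightarrow> 'e"
  where "rscale r x \<equiv> smul (of_real r) x"

lemma vector_space_rscale: "vector_space rscale"
  by unfold_locales (simp_all add: scale_right_distrib scale_left_distrib)

text \<open>
  Seminorms over the real scalars only: Hahn-Banach is applied to real functionals, and a gauge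
  need not be balanced over the complex numbers.
\<close>

definition continuous_seminorm :: "('e \<Rightarrow> real) \<Rightarrow> bool"
  where "continuous_seminorm q \<longleftrightarrow>
    sublinear rscale q \<and> (\<forall>x. q (- x) = q x) \<and> (q \<longlongrightarrow> 0) (nhds 0)"

lemma continuous_smul: "continuous_on UNIV (smul c)"
  using continuous_on_compose2[OF continuous_scale, of UNIV "\<lambda>x. (c, x)"]
  by (simp add: continuous_on_Pair)

lemma tendsto_smul:
  assumes "(f \<longlongrightarrow> x) F" shows "((\<lambda>t. smul c (f t)) \<longlongrightarrow> smul c x) F"
  using continuous_on_tendsto_compose[OF continuous_smul assms] by simp

lemma tendsto_rscale_0: "((\<lambda>r. rscale r x) \<longlongrightarrow> 0) (at 0)"
proof -
  have "isCont (\<lambda>(c, x). smul c x) (0, x)"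
    using continuous_scale by (simp add: continuous_on_eq_continuous_at)
  moreover have "((\<lambda>r::real. (of_real r :: 'k, x)) \<longlongrightarrow> (of_real 0, x)) (at 0)"
    by (intro tendsto_intros)
  ultimately show ?thesis
    using isCont_tendsto_compose[of "(0, x)" "\<lambda>(c, x). smul c x" "\<lambda>r::real. (of_real r, x)" "at 0"]
    by simp
qed

lemma continuous_seminorm_nonneg:
  assumes "continuous_seminorm q" shows "0 \<le> q x"
  using sublinear_minus[OF vector_space_rscale, of q x] assms
  by (auto simp: continuous_seminorm_def)

lemma continuous_seminorm_triangle:
  assumes "continuous_seminorm q" shows "q (x + y) \<le> q x + q y"
  using assms by (auto simp: continuous_seminorm_def sublinear_def)

lemma continuous_seminorm_scale:
  assumes "continuous_seminorm q" shows "q (rscale r x) = \<bar>r\<bar> * q x"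
proof (cases "0 \<le> r")
  case True
  then show ?thesis
    using assms sublinear_scale[OF vector_space_rscale] by (simp add: continuous_seminorm_def)
next
  case False
  have "q (rscale r x) = q (rscale (- r) x)"
    using assms by (simp add: continuous_seminorm_def)
  with False show ?thesis
    using assms sublinear_scale[OF vector_space_rscale, of q "- r"]
    by (simp add: continuous_seminorm_def)
qed

lemma continuous_seminorm_continuous:
  assumes q: "continuous_seminorm q" and f: "(f \<longlongrightarrow> x) F"
  shows "((\<lambda>t. q (f t)) \<longlongrightarrow> q x) F"
proof -
  have "((\<lambda>t. f t - x) \<longlongrightarrow> 0) F"
    using tendsto_diff[OF f tendsto_const[of x]] by simp
  then have "((\<lambda>t. q (f t - x)) \<longlongrightarrow> 0) F"
    using q filterlim_compose unfolding continuous_seminorm_def by blast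
  moreover have "\<bar>q (f t) - q x\<bar> \<le> q (f t - x)" for t
    using continuous_seminorm_triangle[OF q, of "f t - x" x]
      continuous_seminorm_triangle[OF q, of "x - f t" "f t"] q
    unfolding continuous_seminorm_def by (smt (verit) diff_add_cancel minus_diff_eq)
  ultimately have "((\<lambda>t. q (f t) - q x) \<longlongrightarrow> 0) F"
    by (intro Lim_null_comparison[of "\<lambda>t. q (f t) - q x" "\<lambda>t. q (f t - x)"]) simp_all
  then show ?thesis by (rule LIM_zero_cancel)
qed

text \<open>
  The seminorm is the Minkowski gauge of \<open>K\<close>, the symmetric part of a convex neighborhood of zero
  inside \<open>U\<close>.
\<close>

lemma continuous_seminorm_small_in_open:
  assumes U: "open U" "0 \<in> U"
  shows "\<exists>q. continuous_seminorm q \<and> {x. q x < 1} \<subseteq> U"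
proof -
  obtain C where C: "C \<subseteq> U" "0 \<in> interior C"
    and conv: "\<And>x y t. x \<in> C \<Longrightarrow> y \<in> C \<Longrightarrow> 0 \<le> t \<Longrightarrow> t \<le> 1 \<Longrightarrow>
      rscale (1 - t) x + rscale t y \<in> C"
    using convex_nhds_base[OF U] by blast
  define K where "K = {x. x \<in> C \<and> - x \<in> C}"
  define V where "V = interior C \<inter> uminus -` interior C"
  have V: "open V" "0 \<in> V" "V \<subseteq> K"
  proof -
    have "continuous_on UNIV (uminus :: 'e \<Rightarrow> 'e)" by (intro continuous_intros)
    then have "open (uminus -` interior C)"
      by (intro open_vimage) auto
    then show "open V" by (auto simp: V_def)
    show "0 \<in> V" "V \<subseteq> K" using C interior_subset[of C] by (auto simp: V_def K_def)
  qed
  have convK: "rscale (1 - t) x + rscale t y \<in> K"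
    if "x \<in> K" "y \<in> K" "0 \<le> t" "t \<le> 1" for x y t
    using that conv[of x y t] conv[of "- x" "- y" t] by (simp add: K_def)
  have starK: "rscale t y \<in> K" if "y \<in> K" "0 \<le> t" "t \<le> 1" for y t
    using convK[of 0 y t] that V by auto
  define Q where "Q x = {t::real. 0 < t \<and> rscale (inverse t) x \<in> K}" for x
  define q where "q x = Inf (Q x)" for x
  have bdd: "bdd_below (Q x)" for x
    by (rule bdd_belowI[of _ 0]) (auto simp: Q_def)
  have ne: "Q x \<noteq> {}" for x
  proof -
    have "eventually (\<lambda>r. rscale r x \<in> V) (at 0)"
      using tendsto_rscale_0[of x] V by (simp add: topological_tendstoD)
    then have "eventually (\<lambda>r. rscale r x \<in> V) (at_right 0)"
      by (simp add: eventually_at_split)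
    then have "eventually (\<lambda>r::real. 0 < r \<and> rscale r x \<in> V) (at_right 0)"
      by (intro eventually_conj eventually_at_right_less)
    then obtain r where "0 < r" "rscale r x \<in> V"
      using eventually_happens[of _ "at_right (0::real)"] by auto
    then have "inverse r \<in> Q x" using V by (auto simp: Q_def)
    then show ?thesis by blast
  qed
  have le: "q x \<le> t" if "t \<in> Q x" for x t
    unfolding q_def using that bdd by (intro cInf_lower)
  have geI: "c \<le> q x" if "\<And>t. t \<in> Q x \<Longrightarrow> c \<le> t" for c x
    unfolding q_def using that ne by (intro cInf_greatest)
  have "sublinear rscale q"
  proof (rule sublinearI[OF vector_space_rscale])
    fix x y
    have *: "q (x + y) \<le> s + t" if "s \<in> Q x" "t \<in> Q y" for s t
    proof -
      have st: "0 < s" "0 < t" using that by (auto simp: Q_def)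
      have "rscale (1 - t / (s + t)) (rscale (inverse s) x) + rscale (t / (s + t)) (rscale (inverse t) y) \<in> K"
        using that st by (intro convK) (auto simp: Q_def)
      moreover have "(1 - t / (s + t)) * inverse s = inverse (s + t)"
        "t / (s + t) * inverse t = inverse (s + t)"
        using st by (auto simp: field_simps)
      ultimately have "rscale (inverse (s + t)) x + rscale (inverse (s + t)) y \<in> K"
        by (metis scale_scale of_real_mult)
      then have "s + t \<in> Q (x + y)"
        using st by (simp add: Q_def scale_right_distrib)
      then show ?thesis by (rule le)
    qed
    have "q (x + y) - t \<le> q x" if "t \<in> Q y" for t
      using *[OF _ that] by (intro geI) (auto simp: algebra_simps)
    then have "q (x + y) - q x \<le> q y"
      by (intro geI) (auto simp: algebra_simps)
    then show "q (x + y) \<le> q x + q y" by simp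
  next
    fix r :: real and x assume r: "0 < r"
    have "q (rscale r x) / r \<le> t" if "t \<in> Q x" for t
    proof -
      have "rscale (inverse (r * t)) (rscale r x) = rscale (inverse t) x"
        using r by (simp add: field_simps)
      then have "r * t \<in> Q (rscale r x)"
        using that r unfolding Q_def mem_Collect_eq by (metis mult_pos_pos)
      then show ?thesis using le r by (simp add: field_simps)
    qed
    then have "q (rscale r x) / r \<le> q x" by (intro geI)
    then show "q (rscale r x) \<le> r * q x" using r by (simp add: field_simps)
  qed
  moreover have "q (- x) = q x" for x
    by (auto simp: q_def Q_def K_def conj_commute)
  moreover have "(q \<longlongrightarrow> 0) (nhds 0)"
  proof (rule tendstoI)
    fix e :: real assume e: "0 < e"
    have "((\<lambda>x. rscale (2 / e) x) \<longlongrightarrow> 0) (nhds 0)"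
      using tendsto_smul[of "\<lambda>x. x" 0 "nhds 0" "of_real (2 / e)"] by (simp add: filterlim_ident)
    then have "eventually (\<lambda>x. rscale (2 / e) x \<in> V) (nhds 0)"
      using V by (simp add: topological_tendstoD)
    then show "eventually (\<lambda>x. dist (q x) 0 < e) (nhds 0)"
    proof eventually_elim
      case (elim x)
      then have "e / 2 \<in> Q x" using e V by (auto simp: Q_def)
      then have "q x \<le> e / 2" by (rule le)
      moreover have "0 \<le> q x" by (rule geI) (auto simp: Q_def)
      ultimately show ?case using e by simp
    qed
  qed
  ultimately have "continuous_seminorm q" by (simp add: continuous_seminorm_def)
  moreover have "x \<in> U" if "q x < 1" for x
  proof -
    obtain t where t: "t \<in> Q x" "t < 1"
      using \<open>q x < 1\<close> geI[of x 1] by (meson linorder_not_less)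
    have "rscale t (rscale (inverse t) x) \<in> K"
      by (rule starK) (use t in \<open>auto simp: Q_def simp del: of_real_inverse\<close>)
    then show ?thesis using t C by (auto simp: Q_def K_def)
  qed
  ultimately show ?thesis by blast
qed

lemma dual_linear:
  assumes "f \<in> continuous_dual smul"
  shows "f (u + v) = f u + f v" "f (smul c u) = c * f u" "f 0 = 0"
proof -
  interpret f: Vector_Spaces.linear smul "(*)" f
    using assms by (simp add: continuous_dual_def)
  show "f (u + v) = f u + f v" "f (smul c u) = c * f u" "f 0 = 0"
    by (rule f.add f.scale f.zero)+
qed

lemma dual_sum:
  assumes "f \<in> continuous_dual smul" shows "f (\<Sum>n\<in>F. u n) = (\<Sum>n\<in>F. f (u n))"
  by (induction F rule: infinite_finite_induct) (simp_all add: dual_linear[OF assms])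

abbreviation real_dual :: "('e \<Rightarrow> real) set"
  where "real_dual \<equiv> continuous_dual rscale"

lemma real_dualI:
  assumes q: "continuous_seminorm q" and add: "\<And>x y. f (x + y) = f x + f y"
    and scale: "\<And>r x. f (rscale r x) = r * f x" and le: "\<And>x. \<bar>f x\<bar> \<le> C * q x"
  shows "f \<in> real_dual"
proof -
  have "(f \<longlongrightarrow> f x) (at x)" for x
  proof (rule LIM_zero_cancel, rule Lim_null_comparison[where g = "\<lambda>t. C * q (t - x)"])
    have "norm (f t - f x) \<le> C * q (t - x)" for t
      using le[of "t - x"] add[of "t - x" x] by simp
    then show "eventually (\<lambda>t. norm (f t - f x) \<le> C * q (t - x)) (at x)" by simp
    have "((\<lambda>t. q (t - x)) \<longlongrightarrow> q (x - x)) (at x)"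
      by (intro continuous_seminorm_continuous[OF q] tendsto_intros)
    then show "((\<lambda>t. C * q (t - x)) \<longlongrightarrow> 0) (at x)"
      using continuous_seminorm_scale[OF q, of 0 0] by (intro tendsto_mult_right_zero) simp
  qed
  then have "continuous_on UNIV f" by (simp add: continuous_on_def)
  moreover have "Vector_Spaces.linear rscale (*) f"
    unfolding Vector_Spaces.linear_iff
    using vector_space_rscale add scale vector_space_over_itself.vector_space_axioms by simp
  ultimately show ?thesis by (simp add: continuous_dual_def)
qed

lemma real_functional_norming:
  assumes q: "continuous_seminorm q"
  shows "\<exists>f. f \<in> real_dual \<and> (\<forall>x. \<bar>f x\<bar> \<le> q x) \<and> f y = q y"
proof -
  obtain f where f: "Vector_Spaces.linear rscale (*) f" "\<And>x. f x \<le> q x" "f y = q y"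
    using sublinear_dominates_linear[OF vector_space_rscale, of q y] q
    by (auto simp: continuous_seminorm_def)
  have lin: "f (u + v) = f u + f v" "f (rscale r u) = r * f u" for u v r
    using f(1) by (auto simp: Vector_Spaces.linear_iff)
  have abs: "\<bar>f x\<bar> \<le> q x" for x
  proof -
    have "f (- x) = - f x" using lin(2)[of "-1" x] by simp
    then show ?thesis using f(2)[of x] f(2)[of "- x"] q
      by (simp add: continuous_seminorm_def)
  qed
  then have "f \<in> real_dual" using lin by (intro real_dualI[OF q, where C = 1]) auto
  with f abs show ?thesis by blast
qed

text \<open>
  If the scalars are complex with imaginary unit \<open>j\<close>, then \<open>g x = f x - j f (j x)\<close> is linear over
  them with real part \<open>f\<close>. Domination is all that later arguments use: weak smallness and weak
  boundedness pass from \<open>g\<close> to \<open>f\<close>.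
\<close>

lemma real_dual_dominated:
  assumes f: "f \<in> real_dual"
  shows "\<exists>g\<in>continuous_dual smul. \<forall>x. \<bar>f x\<bar> \<le> norm (g x)"
proof -
  have add: "f (u + v) = f u + f v" and scale: "f (rscale r u) = r * f u" for u v r
    using f by (auto simp: continuous_dual_def Vector_Spaces.linear_iff)
  have minus: "f (- u) = - f u" for u using scale[of "-1" u] by simp
  have cont: "continuous_on UNIV f" using f by (simp add: continuous_dual_def)
  have dualI: "g \<in> continuous_dual smul"
    if "\<And>u v. g (u + v) = g u + g v" "\<And>c u. g (smul c u) = c * g u" "continuous_on UNIV g" for g
    unfolding continuous_dual_def Vector_Spaces.linear_iff
    using that vector_space_axioms vector_space_over_itself.vector_space_axioms by simp
  obtain \<psi> :: "'k \<Rightarrow> complex" where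
    \<psi>: "\<And>x y. \<psi> (x + y) = \<psi> x + \<psi> y" "\<And>x y. \<psi> (x * y) = \<psi> x * \<psi> y"
    "\<And>x. norm (\<psi> x) = norm x" "\<And>r. \<psi> (of_real r) = of_real r"
    and range: "range \<psi> = \<real> \<or> range \<psi> = UNIV"
    using real_or_complex_field_embedding by metis
  have inj: "x = y" if "\<psi> x = \<psi> y" for x y
  proof -
    have "\<psi> (x - y) = 0" using \<psi>(1)[of "x - y" y] that by simp
    then show ?thesis using \<psi>(3)[of "x - y"] by simp
  qed
  show ?thesis
  proof (cases "range \<psi> = UNIV")
    case False
    have real: "\<exists>r. c = of_real r" for c :: 'k
    proof -
      have "\<psi> c \<in> \<real>" using False range by blast
      then obtain r where "\<psi> c = of_real r" by (auto elim: Reals_cases)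
      then show ?thesis using inj \<psi>(4) by metis
    qed
    define g where "g x = (of_real (f x) :: 'k)" for x
    have "g (smul c x) = c * g x" for c x
      using real[of c] scale by (auto simp: g_def)
    moreover have "continuous_on UNIV g"
      unfolding g_def by (intro continuous_intros cont)
    ultimately have "g \<in> continuous_dual smul"
      by (intro dualI) (auto simp: g_def add)
    then show ?thesis by (intro bexI[of _ g]) (auto simp: g_def)
  next
    case True
    then obtain j where j: "\<psi> j = \<i>" by (metis surjD)
    have jj: "j * j = - 1"
      using \<psi>(2)[of j j] \<psi>(4)[of "-1"] j by (intro inj) simp
    have decomp: "\<exists>a b. c = of_real a + j * of_real b" for c :: 'k
      by (intro exI[of _ "Re (\<psi> c)"] exI[of _ "Im (\<psi> c)"] inj)
        (simp add: \<psi> j complex_eq_iff)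
    define g where "g x = of_real (f x) - j * of_real (f (smul j x))" for x
    have "g (smul c x) = c * g x" for c x
    proof -
      obtain a b where c: "c = of_real a + j * of_real b" using decomp by blast
      have 1: "smul c x = rscale a x + rscale b (smul j x)"
        by (simp add: c scale_left_distrib mult.commute)
      have "smul j (smul c x) = rscale a (smul j x) + rscale b (smul (j * j) x)"
        by (simp add: c scale_left_distrib scale_right_distrib distrib_left mult.commute mult.left_commute)
      then have 2: "smul j (smul c x) = rscale a (smul j x) - rscale b x"
        by (simp add: jj)
      have f1: "f (smul c x) = a * f x + b * f (smul j x)"
        unfolding 1 add scale ..
      have f2: "f (smul j (smul c x)) = a * f (smul j x) - b * f x"
        using add[of "rscale a (smul j x)" "- rscale b x"]
        unfolding 2 minus scale by simp
      have "c * g x = of_real a * of_real (f x) - j * (of_real a * of_real (f (smul j x)))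
          + j * (of_real b * of_real (f x)) - (j * j) * (of_real b * of_real (f (smul j x)))"
        by (simp add: g_def c algebra_simps)
      also have "\<dots> = g (smul c x)"
        unfolding g_def f1 f2 jj by (simp add: algebra_simps)
      finally show ?thesis by simp
    qed
    moreover have "continuous_on UNIV g"
      unfolding g_def
      by (intro continuous_intros cont continuous_on_compose2[OF cont continuous_smul]) auto
    moreover have "g (u + v) = g u + g v" for u v
      by (simp add: g_def add scale_right_distrib algebra_simps)
    ultimately have "g \<in> continuous_dual smul" by (intro dualI)
    moreover have "\<bar>f x\<bar> \<le> norm (g x)" for x
    proof -
      have "g x = of_real (f x) + j * of_real (- f (smul j x))" by (simp add: g_def)
      then have "\<psi> (g x) = of_real (f x) + \<i> * of_real (- f (smul j x))"
        by (simp only: \<psi> j)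
      then have "Re (\<psi> (g x)) = f x" by simp
      then show ?thesis using abs_Re_le_cmod[of "\<psi> (g x)"] \<psi>(3) by simp
    qed
    ultimately show ?thesis by blast
  qed
qed

text \<open>
  Mackey's theorem, by a gliding argument instead of Baire category. If \<open>q\<close> is unbounded on \<open>B\<close>,
  pick points \<open>y n\<close> with \<open>q (y n) > 4 ^ n\<close> and functionals \<open>f n \<le> q\<close> attaining \<open>q\<close> there. The
  series of \<open>(1/3) ^ n * f n\<close> with suitable signs is a continuous functional of size at least
  \<open>(4/3) ^ n / 2\<close> at \<open>y n\<close>.
\<close>

lemma weakly_bounded_imp_bounded:
  assumes q: "continuous_seminorm q"
    and bounded: "\<And>g. g \<in> continuous_dual smul \<Longrightarrow> \<exists>M. \<forall>x\<in>B. norm (g x) \<le> M"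
  shows "\<exists>M. \<forall>x\<in>B. q x \<le> M"
proof (rule ccontr)
  assume "\<not> ?thesis"
  then have "\<exists>x\<in>B. 4 ^ n < q x" for n :: nat by (meson linorder_not_less)
  then obtain y where y: "\<And>n. y n \<in> B" "\<And>n::nat. 4 ^ n < q (y n)" by metis
  have "\<forall>n. \<exists>f. f \<in> real_dual \<and> (\<forall>x. \<bar>f x\<bar> \<le> q x) \<and> f (y n) = q (y n)"
    using real_functional_norming[OF q] by blast
  from choice[OF this] obtain f where
    f: "\<And>n. f n \<in> real_dual" "\<And>n x. \<bar>f n x\<bar> \<le> q x" "\<And>n. f n (y n) = q (y n)"
    by blast
  \<comment> \<open>The partial sums \<open>h n\<close>; each sign agrees with that of the previous partial sum at \<open>y n\<close>, so
    that the new term adds to it in absolute value.\<close>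
  define h :: "nat \<Rightarrow> 'e \<Rightarrow> real" where "h = rec_nat (\<lambda>x. 0)
    (\<lambda>n h x. h x + (if 0 \<le> h (y n) then 1 else - 1) * (1/3) ^ n * f n x)"
  have h0: "h 0 x = 0" and hSuc: "h (Suc n) x =
      h n x + (if 0 \<le> h n (y n) then 1 else - 1) * (1/3) ^ n * f n x" for n x
    by (simp_all add: h_def)
  have large: "(1/3) ^ n * q (y n) \<le> \<bar>h (Suc n) (y n)\<bar>" for n
    using continuous_seminorm_nonneg[OF q, of "y n"] by (auto simp: hSuc f(3))
  have step: "\<bar>h (Suc n) x - h n x\<bar> \<le> (1/3) ^ n * q x" for n x
    using f(2)[of n x] by (auto simp: hSuc abs_mult)
  have summ: "summable (\<lambda>n. h (Suc n) x - h n x)" for x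
    by (rule summable_comparison_test'[where g = "\<lambda>n. (1/3) ^ n * q x" and N = 0])
      (auto intro!: summable_mult2 summable_geometric simp: step)
  define g where "g x = lim (\<lambda>n. h n x)" for x
  have lim: "(\<lambda>n. h n x) \<longlonglongrightarrow> g x" for x
  proof -
    have "convergent (\<lambda>n. \<Sum>i<n. h (Suc i) x - h i x)"
      using summ[of x] by (simp add: summable_iff_convergent)
    then have "convergent (\<lambda>n. h n x)"
      unfolding sum_lessThan_telescope[of "\<lambda>n. h n x"] by (simp add: h0)
    then show ?thesis by (simp add: g_def convergent_LIMSEQ_iff)
  qed
  \<comment> \<open>The tail from \<open>Suc n\<close> on is at most half the lower bound of \<open>large\<close>.\<close>
  have tail: "\<bar>g x - h n x\<bar> \<le> 3 / 2 * (1/3) ^ n * q x" for n x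
  proof -
    have bound: "\<bar>h (n + k) x - h n x\<bar> \<le> 3 / 2 * (1/3) ^ n * q x * (1 - (1/3) ^ k)" for k
    proof (induction k)
      case (Suc k)
      have "\<bar>h (n + Suc k) x - h n x\<bar> \<le> \<bar>h (n + k) x - h n x\<bar> + (1/3) ^ (n + k) * q x"
        using step[of "n + k" x] by simp
      also have "\<dots> \<le> 3 / 2 * (1/3) ^ n * q x * (1 - (1/3) ^ k) + (1/3) ^ (n + k) * q x"
        using Suc by simp
      also have "\<dots> = 3 / 2 * (1/3) ^ n * q x * (1 - (1/3) ^ Suc k)"
        by (simp add: power_add field_simps)
      finally show ?case .
    qed simp
    have "\<bar>h (n + k) x - h n x\<bar> \<le> 3 / 2 * (1/3) ^ n * q x" for k
    proof -
      have "3 / 2 * (1/3) ^ n * q x * (1 - (1/3) ^ k) \<le> 3 / 2 * (1/3) ^ n * q x"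
        using continuous_seminorm_nonneg[OF q, of x]
        by (intro mult_left_le) (auto simp: power_le_one)
      with bound[of k] show ?thesis by linarith
    qed
    moreover have "(\<lambda>k. \<bar>h (k + n) x - h n x\<bar>) \<longlonglongrightarrow> \<bar>g x - h n x\<bar>"
      by (intro tendsto_intros LIMSEQ_ignore_initial_segment lim)
    ultimately show ?thesis
      by (intro LIMSEQ_le_const2) (auto simp: add.commute)
  qed
  have "g \<in> real_dual"
  proof (rule real_dualI[OF q])
    have add: "f n (u + v) = f n u + f n v" and scale: "f n (rscale r u) = r * f n u" for n u v r
      using f(1)[of n] by (auto simp: continuous_dual_def Vector_Spaces.linear_iff)
    have hadd: "h n (u + v) = h n u + h n v" for n u v
      by (induction n) (simp_all add: h0 hSuc add algebra_simps)
    have hscale: "h n (rscale r u) = r * h n u" for n r u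
      by (induction n) (simp_all add: h0 hSuc scale algebra_simps)
    show "g (u + v) = g u + g v" for u v
      using lim[of "u + v"] tendsto_add[OF lim[of u] lim[of v]]
      by (auto simp: hadd intro: LIMSEQ_unique)
    show "g (rscale r u) = r * g u" for r u
      using lim[of "rscale r u"] tendsto_mult_left[OF lim[of u], of r]
      by (auto simp: hscale intro: LIMSEQ_unique)
    show "\<bar>g x\<bar> \<le> 3 / 2 * q x" for x using tail[of x 0] by (simp add: h0)
  qed
  then obtain G where G: "G \<in> continuous_dual smul" "\<And>x. \<bar>g x\<bar> \<le> norm (G x)"
    using real_dual_dominated by metis
  then obtain M where M: "\<And>x. x \<in> B \<Longrightarrow> norm (G x) \<le> M" using bounded by metis
  have "(4/3) ^ n / 2 \<le> M" for n
  proof -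
    have "\<bar>g (y n)\<bar> \<ge> (1/3) ^ n * q (y n) / 2"
    proof -
      have "\<bar>h (Suc n) (y n)\<bar> \<le> \<bar>g (y n)\<bar> + \<bar>g (y n) - h (Suc n) (y n)\<bar>" by linarith
      moreover have "\<bar>g (y n) - h (Suc n) (y n)\<bar> \<le> (1/3) ^ n * q (y n) / 2"
        using tail[of "y n" "Suc n"] by simp
      ultimately show ?thesis using large[of n] by linarith
    qed
    moreover have "(1/3) ^ n * q (y n) / 2 \<ge> (1/3) ^ n * 4 ^ n / (2::real)"
      using y(2)[of n] by (intro divide_right_mono mult_left_mono) auto
    moreover have "(1/3) ^ n * 4 ^ n = (4/3 :: real) ^ n"
      by (simp flip: power_mult_distrib)
    ultimately show ?thesis using G(2)[of "y n"] M[OF y(1)[of n]] by simp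
  qed
  moreover obtain n where "2 * M < (4/3) ^ n"
    using real_arch_pow[of "4/3" "2 * M"] by auto
  ultimately show False by (smt (verit) field_sum_of_halves)
qed

lemma tendsto_0_iff_seminorms:
  "(f \<longlongrightarrow> 0) F \<longleftrightarrow> (\<forall>q. continuous_seminorm q \<longrightarrow> ((\<lambda>t. q (f t)) \<longlongrightarrow> 0) F)"
proof (intro iffI allI impI)
  fix q assume "(f \<longlongrightarrow> 0) F" "continuous_seminorm q"
  then show "((\<lambda>t. q (f t)) \<longlongrightarrow> 0) F"
    using continuous_seminorm_continuous[of q f 0 F] continuous_seminorm_scale[of q 0 0] by simp
next
  assume *: "\<forall>q. continuous_seminorm q \<longrightarrow> ((\<lambda>t. q (f t)) \<longlongrightarrow> 0) F"
  show "(f \<longlongrightarrow> 0) F"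
  proof (rule topological_tendstoI)
    fix U :: "'e set" assume "open U" "0 \<in> U"
    then obtain q where q: "continuous_seminorm q" "{x. q x < 1} \<subseteq> U"
      using continuous_seminorm_small_in_open by blast
    have "eventually (\<lambda>t. q (f t) < 1) F"
      using * q order_tendstoD(2)[of "\<lambda>t. q (f t)" 0 F 1] by simp
    then show "eventually (\<lambda>t. f t \<in> U) F" by (rule eventually_mono) (use q(2) in auto)
  qed
qed

text \<open>
  For a functional \<open>f \<le> q\<close> that attains \<open>q (x n)\<close>, the number \<open>q (x n) = f (x n - x m) + f (x m)\<close> is
  small: the first summand by the Cauchy property, the second one as \<open>m\<close> tends to infinity.
\<close>

lemma weakly_null_Cauchy_imp_null:
  assumes C: "Cauchy x" and weak: "\<And>g. g \<in> continuous_dual smul \<Longrightarrow> (\<lambda>n. g (x n)) \<longlonglongrightarrow> 0"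
  shows "x \<longlonglongrightarrow> 0"
  unfolding tendsto_0_iff_seminorms
proof (intro allI impI LIMSEQ_I)
  fix q and e :: real assume q: "continuous_seminorm q" and e: "0 < e"
  have "eventually (\<lambda>x. q x < e / 2) (nhds 0)"
    using q e order_tendstoD(2)[of q 0 "nhds 0" "e / 2"] by (simp add: continuous_seminorm_def)
  then obtain U where U: "open U" "0 \<in> U" "\<And>x. x \<in> U \<Longrightarrow> q x < e / 2"
    by (auto simp: eventually_nhds)
  then obtain N where N: "\<And>m n. N \<le> m \<Longrightarrow> N \<le> n \<Longrightarrow> x m - x n \<in> U"
    using C unfolding Cauchy_iff_nhds_0 by meson
  have "q (x n) < e" if n: "N \<le> n" for n
  proof -
    obtain f where f: "f \<in> real_dual" "\<And>z. \<bar>f z\<bar> \<le> q z" "f (x n) = q (x n)"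
      using real_functional_norming[OF q] by blast
    then obtain g where g: "g \<in> continuous_dual smul" "\<And>z. \<bar>f z\<bar> \<le> norm (g z)"
      using real_dual_dominated by metis
    have "(\<lambda>m. f (x m)) \<longlonglongrightarrow> 0"
      using tendsto_norm_zero[OF weak[OF g(1)]] g(2)
      by (intro Lim_null_comparison[of "\<lambda>m. f (x m)" "\<lambda>m. norm (g (x m))"]) auto
    then have lim: "(\<lambda>m. e / 2 + f (x m)) \<longlonglongrightarrow> e / 2 + 0" by (intro tendsto_intros)
    have "q (x n) \<le> e / 2 + f (x m)" if "N \<le> m" for m
    proof -
      have "f (u + v) = f u + f v" for u v
        using f(1) by (simp add: continuous_dual_def Vector_Spaces.linear_iff)
      from this[of "x n - x m" "x m"] have "f (x n) = f (x n - x m) + f (x m)" by simp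
      moreover have "f (x n - x m) \<le> e / 2"
        using f(2)[of "x n - x m"] U(3)[OF N[OF n that]] by simp
      ultimately show ?thesis using f(3) by simp
    qed
    then have "q (x n) \<le> e / 2 + 0"
      by (intro LIMSEQ_le_const[OF lim]) auto
    then show ?thesis using e by simp
  qed
  then show "\<exists>N. \<forall>n\<ge>N. norm (q (x n) - 0) < e"
    using continuous_seminorm_nonneg[OF q] by auto
qed

lemma weakly_summable_imp_weakly_null:
  assumes p: "0 < p" and "weakly_p_summable p smul x" "f \<in> continuous_dual smul"
  shows "(\<lambda>n. f (x n)) \<longlonglongrightarrow> 0"
proof -
  have "(\<lambda>n. norm (f (x n)) powr p) \<longlonglongrightarrow> 0"
    using assms by (intro summable_LIMSEQ_zero) (auto simp: weakly_p_summable_def lp_def)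
  then have "(\<lambda>n. (norm (f (x n)) powr p) powr (1 / p)) \<longlonglongrightarrow> 0"
    using p by (intro tendsto_zero_powrI[where g = "\<lambda>_. 1 / p" and b = "1 / p"]) auto
  then show ?thesis using p by (simp add: powr_powr tendsto_norm_zero_iff)
qed

definition partial_sum :: "(nat \<Rightarrow> 'e) \<Rightarrow> (nat \<Rightarrow> 'k) \<Rightarrow> nat \<Rightarrow> 'e"
  where "partial_sum x a m = (\<Sum>n<m. smul (a n) (x n))"

lemma partial_sum_add: "partial_sum x (a + b) m = partial_sum x a m + partial_sum x b m"
  by (simp add: partial_sum_def scale_left_distrib sum.distrib)

lemma partial_sum_scale: "partial_sum x (seq_scale c a) m = smul c (partial_sum x a m)"
  by (simp add: partial_sum_def seq_scale_def scale_sum_right)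

end

section \<open>Sequence spaces\<close>

definition restrict_seq :: "nat set \<Rightarrow> (nat \<Rightarrow> 'k::zero) \<Rightarrow> nat \<Rightarrow> 'k"
  where "restrict_seq A a = (\<lambda>n. if n \<in> A then a n else 0)"

lemma vector_space_seq_scale: "vector_space (seq_scale :: 'k::real_normed_field \<Rightarrow> _)"
  by unfold_locales (auto simp: seq_scale_def algebra_simps)

lemma finite_support_eq_sum:
  fixes a :: "nat \<Rightarrow> 'k::real_normed_field"
  assumes "finite F" "\<And>n. n \<notin> F \<Longrightarrow> a n = 0"
  shows "a = (\<Sum>n\<in>F. seq_scale (a n) (unit_vector n))"
proof
  fix k
  have *: "(\<Sum>n\<in>G. f n) k = (\<Sum>n\<in>G. f n k)" for f :: "nat \<Rightarrow> nat \<Rightarrow> 'k" and G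
    by (induction G rule: infinite_finite_induct) auto
  show "a k = (\<Sum>n\<in>F. seq_scale (a n) (unit_vector n)) k"
    using assms by (auto simp: * seq_scale_def unit_vector_def if_distrib[of "\<lambda>x. _ * x"] sum.delta cong: if_cong)
qed

lemma unit_vector_span_eq:
  "(unit_vector_span :: (nat \<Rightarrow> 'k::real_normed_field) set) = {a. finite {n. a n \<noteq> 0}}"
proof -
  interpret vector_space "seq_scale :: 'k \<Rightarrow> _" by (rule vector_space_seq_scale)
  have "subspace {a :: nat \<Rightarrow> 'k. finite {n. a n \<noteq> 0}}"
  proof (rule subspaceI; clarsimp?)
    show "finite {n. a n + b n \<noteq> 0}" if "finite {n. a n \<noteq> 0}" "finite {n. b n \<noteq> 0}"
      for a b :: "nat \<Rightarrow> 'k"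
      by (rule finite_subset[OF _ finite_UnI[OF that]]) auto
    show "finite {n. seq_scale c a n \<noteq> 0}" if "finite {n. a n \<noteq> 0}" for c and a :: "nat \<Rightarrow> 'k"
      by (rule finite_subset[OF _ that]) (auto simp: seq_scale_def)
  qed
  then have "span (range unit_vector) \<subseteq> {a :: nat \<Rightarrow> 'k. finite {n. a n \<noteq> 0}}"
    by (intro span_minimal) (auto simp: unit_vector_def)
  moreover have "a \<in> span (range unit_vector)" if "finite {n. a n \<noteq> 0}" for a :: "nat \<Rightarrow> 'k"
    by (subst finite_support_eq_sum[OF that]) (simp, intro span_sum span_scale span_base rangeI)
  ultimately show ?thesis by (auto simp: unit_vector_span_def)
qed

lemma finite_support_in_unit_vector_span:
  fixes a :: "nat \<Rightarrow> 'k::real_normed_field"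
  assumes "finite F" "\<And>n. n \<notin> F \<Longrightarrow> a n = 0"
  shows "a \<in> unit_vector_span"
  unfolding unit_vector_span_eq using assms by (auto intro: finite_subset[of _ F])

lemma restrict_seq_in_span: "finite A \<Longrightarrow> restrict_seq A a \<in> unit_vector_span"
  by (rule finite_support_in_unit_vector_span) (auto simp: restrict_seq_def)

text \<open>
  What the argument needs of the domain \<open>Y\<close>, with norm \<open>N\<close>: the finitely supported sequences are
  dense via truncation (\<open>N_tail\<close>), and \<open>N\<close> is dual to the \<open>p\<close>-norm on finite sets of coordinates
  (\<open>Holder\<close>, and \<open>norming\<close> for its sharpness). The bound in \<open>norming\<close> is the value of \<open>N\<close> before
  normalization; this spares a division by zero when \<open>g\<close> vanishes on \<open>F\<close>. The triangle inequality
  for \<open>N\<close> is contained in \<open>metric\<close>.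
\<close>

locale normed_sequence_space =
  fixes Y :: "(nat \<Rightarrow> 'a::real_or_complex_field) set"
    and N :: "(nat \<Rightarrow> 'a) \<Rightarrow> real" and p :: real
  assumes p_ge_1: "1 \<le> p"
    and metric: "Metric_space Y (\<lambda>a b. N (\<lambda>n. a n - b n))"
    and span_subset: "unit_vector_span \<subseteq> Y"
    and add_closed: "a \<in> Y \<Longrightarrow> b \<in> Y \<Longrightarrow> a + b \<in> Y"
    and scale_closed: "a \<in> Y \<Longrightarrow> seq_scale c a \<in> Y"
    and N_scale: "a \<in> Y \<Longrightarrow> N (seq_scale c a) = norm c * N a"
    and coord_le: "a \<in> Y \<Longrightarrow> norm (a n) \<le> N a"
    and N_tail: "a \<in> Y \<Longrightarrow> (\<lambda>m. N (a - restrict_seq {..<m} a)) \<longlonglongrightarrow> 0"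
    and Holder: "a \<in> Y \<Longrightarrow> finite F \<Longrightarrow>
      norm (\<Sum>n\<in>F. a n * g n) \<le> N a * (\<Sum>n\<in>F. norm (g n) powr p) powr (1 / p)"
    and norming: "finite F \<Longrightarrow> \<exists>a. (\<forall>n. n \<notin> F \<longrightarrow> a n = 0) \<and>
      (\<Sum>n\<in>F. a n * g n) = of_real (\<Sum>n\<in>F. norm (g n) powr p) \<and>
      N a \<le> (\<Sum>n\<in>F. norm (g n) powr p) powr (1 - 1 / p)"
begin

lemma zero_closed: "0 \<in> Y"
  using span_subset finite_support_in_unit_vector_span[of "{}" 0] by auto

lemma minus_closed: "a \<in> Y \<Longrightarrow> - a \<in> Y"
  using scale_closed[of a "- 1"] by (simp add: seq_scale_def fun_Compl_def)

lemma diff_closed: "a \<in> Y \<Longrightarrow> b \<in> Y \<Longrightarrow> a - b \<in> Y"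
  using add_closed[of a "- b"] minus_closed by simp

lemma N_nonneg: "a \<in> Y \<Longrightarrow> 0 \<le> N a"
  using coord_le[of a 0] norm_ge_zero order_trans by blast

lemma N_0: "N 0 = 0"
  using N_scale[OF zero_closed, of 0] by (simp add: seq_scale_def zero_fun_def)

lemma N_minus: "a \<in> Y \<Longrightarrow> N (- a) = N a"
  using N_scale[of a "- 1"] by (simp add: seq_scale_def fun_Compl_def)

lemma N_triangle:
  assumes "a \<in> Y" "b \<in> Y" shows "N (a + b) \<le> N a + N b"
proof -
  interpret Metric_space Y "\<lambda>a b. N (\<lambda>n. a n - b n)" by (rule metric)
  show ?thesis
    using triangle[OF assms(1) zero_closed minus_closed[OF assms(2)]]
    by (simp add: plus_fun_def fun_Compl_def)
qed

abbreviation top_Y :: "(nat \<Rightarrow> 'a) topology"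
  where "top_Y \<equiv> Metric_space.mtopology Y (\<lambda>a b. N (\<lambda>n. a n - b n))"

lemma topspace_top_Y [simp]: "topspace top_Y = Y"
  by (rule Metric_space.topspace_mtopology[OF metric])

lemma openin_top_Y: "openin top_Y V \<longleftrightarrow>
    V \<subseteq> Y \<and> (\<forall>a\<in>V. \<exists>\<delta>>0. \<forall>b\<in>Y. N (a - b) < \<delta> \<longrightarrow> b \<in> V)"
proof -
  interpret Metric_space Y "\<lambda>a b. N (\<lambda>n. a n - b n)" by (rule metric)
  have "(mball a r \<subseteq> V) = (\<forall>b\<in>Y. N (a - b) < r \<longrightarrow> b \<in> V)" if "V \<subseteq> Y" "a \<in> V" for a r
    using that by (auto simp: mball_def fun_diff_def)
  then show ?thesis unfolding openin_mtopology by blast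
qed

lemma zero_neighborhood_top_Y:
  "zero_neighborhood top_Y U \<longleftrightarrow> U \<subseteq> Y \<and> (\<exists>\<delta>>0. \<forall>a\<in>Y. N a < \<delta> \<longrightarrow> a \<in> U)"
proof
  assume "zero_neighborhood top_Y U"
  then obtain V where V: "U \<subseteq> Y" "openin top_Y V" "0 \<in> V" "V \<subseteq> U"
    by (auto simp: zero_neighborhood_def)
  then obtain \<delta> where "\<delta> > 0" "\<forall>b\<in>Y. N (0 - b) < \<delta> \<longrightarrow> b \<in> V"
    unfolding openin_top_Y by blast
  with V show "U \<subseteq> Y \<and> (\<exists>\<delta>>0. \<forall>a\<in>Y. N a < \<delta> \<longrightarrow> a \<in> U)"
    by (intro conjI exI[of _ \<delta>]) (auto simp: N_minus)
next
  assume "U \<subseteq> Y \<and> (\<exists>\<delta>>0. \<forall>a\<in>Y. N a < \<delta> \<longrightarrow> a \<in> U)"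
  then obtain \<delta> where \<delta>: "U \<subseteq> Y" "\<delta> > 0" "\<And>a. a \<in> Y \<Longrightarrow> N a < \<delta> \<Longrightarrow> a \<in> U" by blast
  have "openin top_Y {a \<in> Y. N a < \<delta>}"
    unfolding openin_top_Y
  proof (intro conjI ballI)
    fix a assume "a \<in> {a \<in> Y. N a < \<delta>}"
    then have a: "a \<in> Y" "N a < \<delta>" by auto
    have "N b < \<delta>" if "b \<in> Y" "N (a - b) < \<delta> - N a" for b
      using N_triangle[of a "- (a - b)"] N_minus[of "a - b"] diff_closed minus_closed a that by simp
    then show "\<exists>\<delta>'>0. \<forall>b\<in>Y. N (a - b) < \<delta>' \<longrightarrow> b \<in> {a \<in> Y. N a < \<delta>}"
      using a by (intro exI[of _ "\<delta> - N a"]) auto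
  qed auto
  with \<delta> show "zero_neighborhood top_Y U"
    unfolding zero_neighborhood_def
    by (intro conjI exI[of _ "{a \<in> Y. N a < \<delta>}"]) (auto simp: zero_closed N_0)
qed

end

lemma normed_sequence_space_subspace:
  assumes "normed_sequence_space X N p" "Y \<subseteq> X" "unit_vector_span \<subseteq> Y"
    and "\<And>a b. a \<in> Y \<Longrightarrow> b \<in> Y \<Longrightarrow> a + b \<in> Y" "\<And>c a. a \<in> Y \<Longrightarrow> seq_scale c a \<in> Y"
  shows "normed_sequence_space Y N p"
proof -
  interpret normed_sequence_space X N p by fact
  show ?thesis
    using assms(2-) p_ge_1 Metric_space.subspace[OF metric \<open>Y \<subseteq> X\<close>]
      N_scale coord_le N_tail Holder norming
    by (intro normed_sequence_space.intro) (blast intro: order_trans)+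
qed

lemma normed_sequence_space_span:
  assumes "normed_sequence_space X N p"
  shows "normed_sequence_space unit_vector_span N p"
proof (rule normed_sequence_space_subspace[OF assms])
  interpret vector_space "seq_scale :: 'a \<Rightarrow> _" by (rule vector_space_seq_scale)
  show "unit_vector_span \<subseteq> X" using assms by (rule normed_sequence_space.span_subset)
  show "a + b \<in> unit_vector_span" if "a \<in> unit_vector_span" "b \<in> unit_vector_span" for a b :: "nat \<Rightarrow> 'a"
    using that by (simp add: unit_vector_span_def span_add)
  show "seq_scale c a \<in> unit_vector_span" if "a \<in> unit_vector_span" for c and a :: "nat \<Rightarrow> 'a"
    using that by (simp add: unit_vector_span_def span_scale)
qed simp

lemma subtopology_mtopology:
  assumes "Metric_space X d" "Y \<subseteq> X"
  shows "subtopology (Metric_space.mtopology X d) Y = Metric_space.mtopology Y d"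
proof -
  interpret Submetric X d Y
    using assms by (simp add: Submetric_def Submetric_axioms_def)
  show ?thesis by (simp add: mtopology_submetric)
qed

lemma lp_norm_finite_support:
  assumes "finite F" "\<And>n. n \<notin> F \<Longrightarrow> a n = 0"
  shows "lp_norm r a = (\<Sum>n\<in>F. norm (a n) powr r) powr (1 / r)"
  unfolding lp_norm_def using assms by (subst suminf_finite[of F]) auto

lemma lp_norm_scale:
  fixes a :: "nat \<Rightarrow> 'k::real_normed_field"
  assumes "a \<in> lp r" "0 < r"
  shows "seq_scale c a \<in> lp r" "lp_norm r (seq_scale c a) = norm c * lp_norm r a"
proof -
  have s: "summable (\<lambda>n. norm (a n) powr r)" using assms by (simp add: lp_def)
  have *: "norm (seq_scale c a n) powr r = norm c powr r * norm (a n) powr r" for n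
    by (simp add: seq_scale_def norm_mult powr_mult)
  show "seq_scale c a \<in> lp r"
    unfolding lp_def mem_Collect_eq * using s by (rule summable_mult)
  have "lp_norm r (seq_scale c a) = (norm c powr r * (\<Sum>n. norm (a n) powr r)) powr (1 / r)"
    unfolding lp_norm_def * by (subst suminf_mult[OF s]) simp
  also have "\<dots> = norm c * lp_norm r a"
    using assms s by (simp add: powr_mult suminf_nonneg powr_powr lp_norm_def)
  finally show "lp_norm r (seq_scale c a) = norm c * lp_norm r a" .
qed

lemma lp_coord_le:
  assumes "a \<in> lp r" "0 < r" shows "norm (a n) \<le> lp_norm r a"
proof -
  have s: "summable (\<lambda>n. norm (a n) powr r)" using assms by (simp add: lp_def)
  have "norm (a n) powr r \<le> (\<Sum>n. norm (a n) powr r)"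
    using sum_le_suminf[OF s, of "{n}"] by simp
  then have "(norm (a n) powr r) powr (1 / r) \<le> lp_norm r a"
    unfolding lp_norm_def using assms by (intro powr_mono2) auto
  then show ?thesis using assms by (simp add: powr_powr)
qed

lemma lp_norm_tail:
  fixes a :: "nat \<Rightarrow> 'k::real_normed_vector"
  assumes "a \<in> lp r" "0 < r" shows "(\<lambda>m. lp_norm r (a - restrict_seq {..<m} a)) \<longlonglongrightarrow> 0"
proof -
  let ?f = "\<lambda>n. norm (a n) powr r"
  have s: "summable ?f" using assms by (simp add: lp_def)
  have *: "(\<lambda>n. norm ((a - restrict_seq {..<m} a) n) powr r) sums (suminf ?f - (\<Sum>n<m. ?f n))" for m
  proof -
    have "(\<lambda>n. ?f n - (if n \<in> {..<m} then ?f n else 0)) sums (suminf ?f - (\<Sum>n<m. ?f n))"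
      by (intro sums_diff summable_sums s sums_If_finite_set) auto
    moreover have "?f n - (if n \<in> {..<m} then ?f n else 0) = norm ((a - restrict_seq {..<m} a) n) powr r" for n
      by (simp add: restrict_seq_def)
    ultimately show ?thesis by simp
  qed
  have "(\<lambda>m. suminf ?f - (\<Sum>n<m. ?f n)) \<longlonglongrightarrow> suminf ?f - suminf ?f"
    by (intro tendsto_intros summable_LIMSEQ s)
  then have "(\<lambda>m. (suminf ?f - (\<Sum>n<m. ?f n)) powr (1 / r)) \<longlonglongrightarrow> 0"
    using assms by (intro tendsto_zero_powrI[where b = "1 / r"])
      (auto intro!: sum_le_suminf s always_eventually)
  then show ?thesis unfolding lp_norm_def sums_unique[OF *, symmetric] .
qed

text \<open>
  Young's inequality termwise, after normalizing both factors.
\<close>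

lemma lp_Holder:
  fixes a g :: "nat \<Rightarrow> 'k::real_normed_field"
  assumes pq: "1 < p" "1 < q" "1 / p + 1 / q = 1" and a: "a \<in> lp q" and F: "finite F"
  shows "norm (\<Sum>n\<in>F. a n * g n) \<le> lp_norm q a * (\<Sum>n\<in>F. norm (g n) powr p) powr (1 / p)"
proof -
  define A B where "A = lp_norm q a" and "B = (\<Sum>n\<in>F. norm (g n) powr p) powr (1 / p)"
  have s: "summable (\<lambda>n. norm (a n) powr q)" using a by (simp add: lp_def)
  have AB: "0 \<le> A" "0 \<le> B" by (simp_all add: A_def B_def lp_norm_nonneg)
  have sumnn: "0 \<le> (\<Sum>n\<in>F. norm (g n) powr p)" by (intro sum_nonneg) simp
  show ?thesis
  proof (cases "A = 0 \<or> B = 0")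
    case True
    have "a n * g n = 0" if n: "n \<in> F" for n
    proof (cases "A = 0")
      case True
      then show ?thesis using lp_norm_eq_0_iff[of q a] a pq by (simp add: A_def)
    next
      case False
      then have "(\<Sum>n\<in>F. norm (g n) powr p) = 0" using \<open>A = 0 \<or> B = 0\<close> by (simp add: B_def)
      then show ?thesis using F n by (subst (asm) sum_nonneg_eq_0_iff) auto
    qed
    then show ?thesis using AB by (simp add: A_def B_def sum.neutral del: mult_eq_0_iff)
  next
    case False
    with AB have AB: "0 < A" "0 < B" by auto
    have Aq: "A powr q = (\<Sum>n. norm (a n) powr q)"
      using lp_norm_powr[of q a] a pq by (simp add: A_def)
    have Bp: "B powr p = (\<Sum>n\<in>F. norm (g n) powr p)"
      using pq sumnn by (simp add: B_def powr_powr)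
    have "(\<Sum>n\<in>F. norm (a n) / A * (norm (g n) / B))
        \<le> (\<Sum>n\<in>F. (norm (a n) / A) powr q / q + (norm (g n) / B) powr p / p)"
      using pq AB by (intro sum_mono Youngs_inequality) auto
    also have "\<dots> = (\<Sum>n\<in>F. norm (a n) powr q) / A powr q / q
        + (\<Sum>n\<in>F. norm (g n) powr p) / B powr p / p"
      using AB by (simp add: powr_divide sum.distrib sum_divide_distrib)
    also have "\<dots> \<le> 1 / q + 1 / p"
    proof (intro add_mono divide_right_mono)
      show "(\<Sum>n\<in>F. norm (a n) powr q) / A powr q \<le> 1"
        using sum_le_suminf[OF s F] AB by (simp add: Aq[symmetric])
      show "(\<Sum>n\<in>F. norm (g n) powr p) / B powr p \<le> 1"
        using AB by (simp add: Bp[symmetric])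
    qed (use pq in auto)
    finally have "(\<Sum>n\<in>F. norm (a n) / A * (norm (g n) / B)) \<le> 1" using pq by simp
    moreover have "(\<Sum>n\<in>F. norm (a n) / A * (norm (g n) / B)) = (\<Sum>n\<in>F. norm (a n * g n)) / (A * B)"
      by (simp add: sum_divide_distrib norm_mult)
    ultimately have "(\<Sum>n\<in>F. norm (a n * g n)) \<le> A * B"
      using AB by (simp add: divide_le_eq)
    then show ?thesis
      using norm_sum[of "\<lambda>n. a n * g n" F] by (simp add: A_def B_def)
  qed
qed

lemma normed_sequence_space_lp:
  assumes pq: "1 < p" "1 < q" "1 / p + 1 / q = 1"
  shows "normed_sequence_space (lp q :: (nat \<Rightarrow> 'k::real_or_complex_field) set) (lp_norm q) p"
proof (rule normed_sequence_space.intro)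
  have q: "0 < q" using pq by simp
  show "1 \<le> p" using pq by simp
  show "Metric_space (lp q) (\<lambda>a b :: nat \<Rightarrow> 'k. lp_norm q (\<lambda>n. a n - b n))"
    using pq by (intro Metric_space_lp) simp
  show "unit_vector_span \<subseteq> (lp q :: (nat \<Rightarrow> 'k) set)"
  proof
    fix a :: "nat \<Rightarrow> 'k" assume "a \<in> unit_vector_span"
    then have "finite {n. a n \<noteq> 0}" by (simp add: unit_vector_span_eq)
    then show "a \<in> lp q"
      unfolding lp_def mem_Collect_eq by (rule summable_finite) auto
  qed
  fix a b :: "nat \<Rightarrow> 'k" and c n
  show "a + b \<in> lp q" if "a \<in> lp q" "b \<in> lp q"
    using lp_add_closed[of q a b] that pq by (simp add: plus_fun_def)
  assume a: "a \<in> lp q"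
  show "seq_scale c a \<in> lp q" "lp_norm q (seq_scale c a) = norm c * lp_norm q a"
    using lp_norm_scale[OF a q] by auto
  show "norm (a n) \<le> lp_norm q a" by (rule lp_coord_le[OF a q])
  show "(\<lambda>m. lp_norm q (a - restrict_seq {..<m} a)) \<longlonglongrightarrow> 0"
    by (rule lp_norm_tail[OF a q])
next
  fix a g :: "nat \<Rightarrow> 'k" and F :: "nat set"
  assume F: "finite F"
  show "norm (\<Sum>n\<in>F. a n * g n) \<le> lp_norm q a * (\<Sum>n\<in>F. norm (g n) powr p) powr (1 / p)"
    if "a \<in> lp q" by (rule lp_Holder[OF pq that F])
  \<comment> \<open>The equality case of Hoelder's inequality.\<close>
  define b where "b n = (if n \<in> F then of_real (norm (g n) powr p) / g n else 0)" for n
  have exps: "1 / q = 1 - 1 / p" "(p - 1) * q = p" using pq by (auto simp: field_simps)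
  have "norm (b n) powr q = norm (g n) powr p" if "n \<in> F" for n
  proof (cases "g n = 0")
    case False
    then have "norm (b n) = norm (g n) powr (p - 1)"
      using that by (simp add: b_def norm_divide powr_diff)
    then show ?thesis by (simp add: powr_powr exps)
  qed (use that in \<open>simp add: b_def\<close>)
  then have "lp_norm q b = (\<Sum>n\<in>F. norm (g n) powr p) powr (1 - 1 / p)"
    by (subst lp_norm_finite_support[OF F]) (auto simp: b_def exps)
  moreover have "(\<Sum>n\<in>F. b n * g n) = of_real (\<Sum>n\<in>F. norm (g n) powr p)"
    by (auto simp: b_def intro!: sum.cong)
  ultimately show "\<exists>a. (\<forall>n. n \<notin> F \<longrightarrow> a n = 0) \<and>
      (\<Sum>n\<in>F. a n * g n) = of_real (\<Sum>n\<in>F. norm (g n) powr p) \<and>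
      lp_norm q a \<le> (\<Sum>n\<in>F. norm (g n) powr p) powr (1 - 1 / p)"
    by (intro exI[of _ b]) (simp add: b_def)
qed

lemma sup_norm_le:
  assumes "\<And>n. norm (a n) \<le> M" shows "sup_norm a \<le> M"
proof -
  have "bounded (range a)" using assms by (auto simp: bounded_iff)
  then show ?thesis unfolding sup_norm_def using assms by (auto intro!: cSUP_least)
qed

lemma norm_le_sup_norm:
  assumes "bounded (range a)" shows "norm (a n) \<le> sup_norm a"
proof -
  have "bdd_above (range (\<lambda>n. norm (a n)))"
    using assms by (auto simp: bounded_iff intro: bdd_aboveI2)
  then show ?thesis using assms by (auto simp: sup_norm_def intro: cSUP_upper)
qed

lemma c0_bounded: "a \<in> c0 \<Longrightarrow> bounded (range a)"
  by (auto simp: c0_def intro: convergent_imp_bounded)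

lemma normed_sequence_space_c0:
  "normed_sequence_space (c0 :: (nat \<Rightarrow> 'k::real_or_complex_field) set) sup_norm 1"
proof (rule normed_sequence_space.intro)
  show "Metric_space c0 (\<lambda>a b :: nat \<Rightarrow> 'k. sup_norm (\<lambda>n. a n - b n))"
    by (rule Metric_space_c0)
  show "unit_vector_span \<subseteq> (c0 :: (nat \<Rightarrow> 'k) set)"
  proof
    fix a :: "nat \<Rightarrow> 'k" assume "a \<in> unit_vector_span"
    then have "finite {n. a n \<noteq> 0}" by (simp add: unit_vector_span_eq)
    then obtain M where "\<And>n. a n \<noteq> 0 \<Longrightarrow> n \<le> M"
      by (auto simp: finite_nat_set_iff_bounded_le)
    then have "eventually (\<lambda>n. a n = 0) sequentially"
      by (intro eventually_sequentiallyI[of "Suc M"]) (metis Suc_n_not_le_n le_trans)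
    then show "a \<in> c0" by (simp add: c0_def tendsto_eventually)
  qed
  fix a b :: "nat \<Rightarrow> 'k" and c n
  show "a + b \<in> c0" if "a \<in> c0" "b \<in> c0"
    using tendsto_add[of a 0 sequentially b 0] that by (simp add: c0_def plus_fun_def)
  assume a: "a \<in> c0"
  show "seq_scale c a \<in> c0"
    using a tendsto_mult_right_zero[of a sequentially c] by (simp add: c0_def seq_scale_def)
  show coord: "norm (a n) \<le> sup_norm a" for n
    by (rule norm_le_sup_norm[OF c0_bounded[OF a]])
  show "sup_norm (seq_scale c a) = norm c * sup_norm a"
  proof (rule antisym)
    show "sup_norm (seq_scale c a) \<le> norm c * sup_norm a"
      by (rule sup_norm_le) (simp add: seq_scale_def norm_mult mult_left_mono coord)
    show "norm c * sup_norm a \<le> sup_norm (seq_scale c a)"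
    proof (cases "c = 0")
      case True
      have "0 \<le> sup_norm (seq_scale c a)"
        using norm_le_sup_norm[OF c0_bounded[OF \<open>seq_scale c a \<in> c0\<close>], of 0] norm_ge_zero order_trans by blast
      then show ?thesis using True by simp
    next
      case False
      have "sup_norm a \<le> sup_norm (seq_scale c a) / norm c"
        using norm_le_sup_norm[OF c0_bounded[OF \<open>seq_scale c a \<in> c0\<close>]] False
        by (intro sup_norm_le) (simp add: seq_scale_def norm_mult field_simps)
      then show ?thesis using False by (simp add: field_simps)
    qed
  qed
  show "(\<lambda>m. sup_norm (a - restrict_seq {..<m} a)) \<longlonglongrightarrow> 0"
  proof (rule LIMSEQ_I)
    fix e :: real assume e: "0 < e"
    then obtain M where M: "\<And>n. M \<le> n \<Longrightarrow> norm (a n) < e / 2"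
      using a LIMSEQ_D[of a 0 "e / 2"] by (auto simp: c0_def)
    have "norm (sup_norm (a - restrict_seq {..<m} a) - 0) < e" if "M \<le> m" for m
    proof -
      have *: "norm ((a - restrict_seq {..<m} a) n) \<le> e / 2" for n
        using M[of n] that e by (auto simp: restrict_seq_def)
      then have "bounded (range (a - restrict_seq {..<m} a))" unfolding bounded_iff by blast
      then have "0 \<le> sup_norm (a - restrict_seq {..<m} a)"
        using norm_le_sup_norm[of _ 0] norm_ge_zero order_trans by blast
      moreover have "sup_norm (a - restrict_seq {..<m} a) \<le> e / 2"
        using * by (rule sup_norm_le)
      ultimately show ?thesis using e by simp
    qed
    then show "\<exists>no. \<forall>m\<ge>no. norm (sup_norm (a - restrict_seq {..<m} a) - 0) < e" by blast
  qed
next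
  fix a g :: "nat \<Rightarrow> 'k" and F :: "nat set"
  assume F: "finite F"
  let ?s = "\<Sum>n\<in>F. norm (g n) powr 1"
  have s: "?s = (\<Sum>n\<in>F. norm (g n))" by simp
  show "norm (\<Sum>n\<in>F. a n * g n) \<le> sup_norm a * ?s powr (1 / 1)" if "a \<in> c0"
  proof -
    have "norm (\<Sum>n\<in>F. a n * g n) \<le> (\<Sum>n\<in>F. sup_norm a * norm (g n))"
      using norm_le_sup_norm[OF c0_bounded[OF that]]
      by (intro sum_norm_le) (simp add: norm_mult mult_right_mono)
    then show ?thesis by (simp add: sum_distrib_left sum_nonneg)
  qed
  \<comment> \<open>Conjugate signs of the coordinates of \<open>g\<close>; division by zero gives 0.\<close>
  define b where "b n = (if n \<in> F then of_real (norm (g n)) / g n else 0)" for n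
  have "sup_norm b \<le> ?s powr (1 - 1 / 1)"
  proof (rule sup_norm_le)
    fix n
    show "norm (b n) \<le> ?s powr (1 - 1 / 1)"
    proof (cases "n \<in> F \<and> g n \<noteq> 0")
      case True
      then have "?s \<noteq> 0" using F by (subst sum_nonneg_eq_0_iff) auto
      then show ?thesis by (auto simp: b_def norm_divide)
    qed (auto simp: b_def)
  qed
  moreover have "(\<Sum>n\<in>F. b n * g n) = of_real ?s"
    by (auto simp: b_def intro!: sum.cong)
  ultimately show "\<exists>a. (\<forall>n. n \<notin> F \<longrightarrow> a n = 0) \<and>
      (\<Sum>n\<in>F. a n * g n) = of_real ?s \<and> sup_norm a \<le> ?s powr (1 - 1 / 1)"
    by (intro exI[of _ b]) (auto simp: b_def)
qed simp

section \<open>Operators on sequence spaces\<close>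

locale operator_setting =
  normed_sequence_space Y N p + locally_convex_space smul
  for Y :: "(nat \<Rightarrow> 'k::real_or_complex_field) set" and N p
    and smul :: "'k \<Rightarrow> 'e::{uniform_topological_group_add, ab_group_add, t2_space} \<Rightarrow> 'e"
begin

abbreviation operator :: "((nat \<Rightarrow> 'k) \<Rightarrow> 'e) \<Rightarrow> bool"
  where "operator \<equiv> operator_on top_Y seq_scale smul"

lemma operator_add: "operator S \<Longrightarrow> a \<in> Y \<Longrightarrow> b \<in> Y \<Longrightarrow> S (a + b) = S a + S b"
  and operator_scale: "operator S \<Longrightarrow> a \<in> Y \<Longrightarrow> S (seq_scale c a) = smul c (S a)"
  by (auto simp: operator_on_def)

lemma operator_0: "operator S \<Longrightarrow> S 0 = 0"
  using operator_add[of S 0 0] zero_closed by simp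

lemma operator_diff: "operator S \<Longrightarrow> a \<in> Y \<Longrightarrow> b \<in> Y \<Longrightarrow> S (a - b) = S a - S b"
  using operator_add[of S "a - b" b] diff_closed by simp

lemma operator_small:
  assumes S: "operator S" and U: "open U" "0 \<in> U"
  shows "\<exists>\<delta>>0. \<forall>a\<in>Y. N a < \<delta> \<longrightarrow> S a \<in> U"
proof -
  have "openin top_Y {a \<in> topspace top_Y. S a \<in> U}"
    using S U(1) by (intro openin_continuous_map_preimage[where Y = euclidean]) (auto simp: operator_on_def)
  moreover have "0 \<in> {a \<in> Y. S a \<in> U}" using zero_closed operator_0[OF S] U by simp
  ultimately have "zero_neighborhood top_Y {a \<in> Y. S a \<in> U}"
    unfolding zero_neighborhood_def by auto
  then show ?thesis unfolding zero_neighborhood_top_Y by blast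
qed

lemma operator_onI:
  assumes add: "\<And>a b. a \<in> Y \<Longrightarrow> b \<in> Y \<Longrightarrow> S (a + b) = S a + S b"
    and scale: "\<And>c a. a \<in> Y \<Longrightarrow> S (seq_scale c a) = smul c (S a)"
    and bound: "\<And>q. continuous_seminorm q \<Longrightarrow> \<exists>M. \<forall>a\<in>Y. q (S a) \<le> M * N a"
  shows "operator S"
proof -
  have "openin top_Y {a \<in> Y. S a \<in> U}" if U: "open U" for U
    unfolding openin_top_Y
  proof (intro conjI ballI)
    fix a assume "a \<in> {a \<in> Y. S a \<in> U}"
    then have a: "a \<in> Y" "S a \<in> U" by auto
    have "open ((\<lambda>z. S a - z) -` U)"
      using U by (intro open_vimage continuous_intros)
    then obtain q where q: "continuous_seminorm q" "{z. q z < 1} \<subseteq> (\<lambda>z. S a - z) -` U"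
      using continuous_seminorm_small_in_open[of "(\<lambda>z. S a - z) -` U"] a by auto
    obtain M where M: "\<And>b. b \<in> Y \<Longrightarrow> q (S b) \<le> M * N b" using bound[OF q(1)] by blast
    have "S b \<in> U" if b: "b \<in> Y" "N (a - b) < 1 / (\<bar>M\<bar> + 1)" for b
    proof -
      have ab: "a - b \<in> Y" using a b by (intro diff_closed)
      have "S a = S (a - b) + S b" using add[OF ab b(1)] by simp
      then have Sb: "S b = S a - S (a - b)" by simp
      have "q (S (a - b)) \<le> M * N (a - b)" by (rule M[OF ab])
      also have "\<dots> \<le> (\<bar>M\<bar> + 1) * N (a - b)"
        using N_nonneg[OF ab] by (intro mult_right_mono) auto
      also have "\<dots> < 1" using b(2) by (simp add: field_simps)
      finally show ?thesis using q(2) Sb by auto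
    qed
    then show "\<exists>\<delta>>0. \<forall>b\<in>Y. N (a - b) < \<delta> \<longrightarrow> b \<in> {a \<in> Y. S a \<in> U}"
      by (intro exI[of _ "1 / (\<bar>M\<bar> + 1)"]) auto
  qed auto
  then have "continuous_map top_Y euclidean S"
    by (auto simp: continuous_map_def)
  then show ?thesis using add scale by (simp add: operator_on_def)
qed

lemma unit_vector_in: "unit_vector n \<in> Y"
  using span_subset finite_support_in_unit_vector_span[of "{n}" "unit_vector n"]
  by (auto simp: unit_vector_def)

lemma N_unit_vector_le: "N (unit_vector n) \<le> 1"
proof -
  obtain a :: "nat \<Rightarrow> 'k" where "\<forall>k. k \<notin> {n} \<longrightarrow> a k = 0" "a n = 1" "N a \<le> 1"
    using norming[of "{n}" "\<lambda>_. 1"] by auto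
  moreover from this have "a = unit_vector n" by (auto simp: unit_vector_def)
  ultimately show ?thesis by simp
qed

lemma functional_of_operator:
  assumes S: "operator S" and f: "f \<in> continuous_dual smul"
    and c: "finite F" "\<And>n. n \<notin> F \<Longrightarrow> c n = 0"
  shows "f (S c) = (\<Sum>n\<in>F. c n * f (S (unit_vector n)))"
proof -
  let ?b = "\<lambda>n. seq_scale (c n) (unit_vector n)"
  have "(\<Sum>n\<in>G. ?b n) \<in> Y \<and> f (S (\<Sum>n\<in>G. ?b n)) = (\<Sum>n\<in>G. c n * f (S (unit_vector n)))"
    if "finite G" for G
    using that
  proof induction
    case empty
    then show ?case using zero_closed operator_0[OF S] dual_linear(3)[OF f] by (simp add: zero_fun_def)
  next
    case (insert n G)
    have c: "?b n \<in> Y" by (intro scale_closed unit_vector_in)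
    then have "f (S (?b n + sum ?b G)) = f (S (?b n)) + f (S (sum ?b G))"
      using insert.IH by (simp add: operator_add[OF S] dual_linear[OF f])
    also have "f (S (?b n)) = c n * f (S (unit_vector n))"
      by (simp add: operator_scale[OF S] unit_vector_in dual_linear[OF f])
    finally show ?case
      unfolding sum.insert[OF insert.hyps] using insert.IH c add_closed by metis
  qed
  then show ?thesis using finite_support_eq_sum[of F c] c by metis
qed

text \<open>
  A continuous functional composed with \<open>S\<close> is bounded by \<open>M * N\<close>; testing it on the norming
  sequences bounds all finite partial \<open>p\<close>-sums of its coefficients by \<open>M powr p\<close>.
\<close>

lemma operator_unit_vectors_weakly_summable:
  assumes S: "operator S"
  shows "weakly_p_summable p smul (\<lambda>n. S (unit_vector n))"
  unfolding weakly_p_summable_def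
proof
  fix f :: "'e \<Rightarrow> 'k" assume f: "f \<in> continuous_dual smul"
  define g where "g n = f (S (unit_vector n))" for n
  have "open (f -` ball 0 1)"
    using f by (intro open_vimage) (auto simp: continuous_dual_def)
  then obtain \<delta> where \<delta>: "\<delta> > 0" "\<And>a. a \<in> Y \<Longrightarrow> N a < \<delta> \<Longrightarrow> norm (f (S a)) < 1"
    using operator_small[OF S, of "f -` ball 0 1"] dual_linear(3)[OF f] by auto
  define M where "M = 2 / \<delta>"
  have bound: "norm (f (S a)) \<le> M * N a" if a: "a \<in> Y" for a
  proof (cases "N a = 0")
    case True
    then have "a n = 0" for n using coord_le[OF a, of n] by simp
    then have "a = 0" by auto
    then show ?thesis using N_0 operator_0[OF S] dual_linear(3)[OF f] by simp
  next
    case False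
    then have pos: "N a > 0" using N_nonneg[OF a] by simp
    define r where "r = \<delta> / (2 * N a)"
    have r: "r > 0" using pos \<delta> by (simp add: r_def)
    have "N (seq_scale (of_real r) a) = \<bar>r\<bar> * N a"
      by (simp only: N_scale[OF a] norm_of_real)
    then have "N (seq_scale (of_real r) a) < \<delta>"
      using r pos \<delta> by (simp add: r_def)
    then have "norm (f (S (seq_scale (of_real r) a))) < 1"
      using \<delta>(2) scale_closed[OF a] by blast
    then have "r * norm (f (S a)) < 1"
      using r by (simp add: operator_scale[OF S a] dual_linear(2)[OF f] norm_mult)
    then show ?thesis using pos \<delta> by (simp add: r_def M_def field_simps)
  qed
  have M: "0 \<le> M" using \<delta> by (simp add: M_def)
  have "(\<Sum>n\<in>F. norm (g n) powr p) \<le> M powr p" if F: "finite F" for F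
  proof -
    let ?s = "\<Sum>n\<in>F. norm (g n) powr p"
    have s: "0 \<le> ?s" by (intro sum_nonneg) simp
    obtain a where a: "\<And>n. n \<notin> F \<Longrightarrow> a n = 0" "(\<Sum>n\<in>F. a n * g n) = of_real ?s"
      "N a \<le> ?s powr (1 - 1 / p)"
      using norming[OF F, of g] by blast
    have "a \<in> Y" using a(1) F span_subset finite_support_in_unit_vector_span by blast
    have "f (S a) = (\<Sum>n\<in>F. a n * g n)"
      unfolding g_def by (rule functional_of_operator[OF S f F a(1)])
    then have "norm (f (S a)) = ?s" using s by (simp only: a(2) norm_of_real abs_of_nonneg)
    \<comment> \<open>Hence \<open>?s \<le> M * ?s powr (1 - 1 / p)\<close>, which is solved for \<open>?s\<close>.\<close>
    then have "?s \<le> M * N a" using bound[OF \<open>a \<in> Y\<close>] by simp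
    also have "\<dots> \<le> M * ?s powr (1 - 1 / p)" using a(3) M by (rule mult_left_mono)
    finally have le: "?s \<le> M * ?s powr (1 - 1 / p)" .
    show ?thesis
    proof (cases "?s = 0")
      case False
      with s have pos: "0 < ?s" by simp
      have "?s = ?s powr (1 / p) * ?s powr (1 - 1 / p)"
        using pos by (simp flip: powr_add)
      with le have "?s powr (1 / p) * ?s powr (1 - 1 / p) \<le> M * ?s powr (1 - 1 / p)" by linarith
      then have "?s powr (1 / p) \<le> M" using pos by (subst (asm) mult_le_cancel_right) auto
      then have "(?s powr (1 / p)) powr p \<le> M powr p"
        using p_ge_1 by (intro powr_mono2) auto
      then show ?thesis using p_ge_1 pos by (simp add: powr_powr)
    qed simp
  qed
  then have "summable (\<lambda>n. norm (g n) powr p)"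
    by (intro bounded_imp_summable[where B = "M powr p"]) auto
  then show "(\<lambda>n. f (S (unit_vector n))) \<in> lp p" by (simp add: lp_def g_def)
qed

text \<open>
  Given where the previous block ends, some \<open>b j\<close> has a small head up to there because \<open>b\<close> tends to
  zero coordinatewise, and the tail of that \<open>b j\<close> is small from a later point on. The chosen
  indices \<open>s i\<close> need not increase, as only membership in the sequence matters later.
\<close>

lemma gliding_hump:
  assumes b: "\<And>i. b i \<in> Y" and null: "\<And>n. (\<lambda>i. b i n) \<longlonglongrightarrow> 0"
  obtains m s :: "nat \<Rightarrow> nat"
  where "strict_mono m"
    "\<And>i. N (b (s i) - restrict_seq {m i..<m (Suc i)} (b (s i))) \<le> (1/2) ^ i"
proof -
  have step: "\<exists>j m'. m < m' \<and> N (b j - restrict_seq {m..<m'} (b j)) \<le> (1/2) ^ i" for m i :: nat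
  proof -
    define e where "e = (1/2 :: real) ^ i / 2"
    have e: "e > 0" by (simp add: e_def)
    have "(\<lambda>j. \<Sum>n<m. norm (b j n)) \<longlonglongrightarrow> (\<Sum>n<m. norm (0::'k))"
      by (intro tendsto_intros null)
    then have "eventually (\<lambda>j. (\<Sum>n<m. norm (b j n)) < e) sequentially"
      using e by (intro order_tendstoD(2)) auto
    from eventually_happens'[OF sequentially_bot this]
    obtain j where j: "(\<Sum>n<m. norm (b j n)) < e" by blast
    have head: "N (restrict_seq {..<m} (b j)) \<le> (\<Sum>n<m. norm (b j n))"
    proof -
      have "(\<Sum>n\<in>G. seq_scale (b j n) (unit_vector n)) \<in> Y \<and>
          N (\<Sum>n\<in>G. seq_scale (b j n) (unit_vector n)) \<le> (\<Sum>n\<in>G. norm (b j n))"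
        if "finite G" for G :: "nat set"
        using that
      proof induction
        case empty
        then show ?case using zero_closed N_0 by (simp add: zero_fun_def)
      next
        case (insert n G)
        have "N (seq_scale (b j n) (unit_vector n)) \<le> norm (b j n)"
          using N_scale[OF unit_vector_in, of "b j n" n] N_unit_vector_le[of n]
          by (simp add: mult_left_le)
        moreover have "seq_scale (b j n) (unit_vector n) \<in> Y" by (intro scale_closed unit_vector_in)
        ultimately show ?case
          unfolding sum.insert[OF insert.hyps]
          using insert.IH by (intro conjI add_closed order_trans[OF N_triangle] add_mono) auto
      qed
      moreover have "restrict_seq {..<m} (b j) = (\<Sum>n<m. seq_scale (b j n) (unit_vector n))"
        by (subst finite_support_eq_sum[of "{..<m}"]) (auto simp: restrict_seq_def)
      ultimately show ?thesis by simp
    qed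
    have "eventually (\<lambda>m'. N (b j - restrict_seq {..<m'} (b j)) < e) sequentially"
      using order_tendstoD(2)[OF N_tail[OF b]] e by blast
    then have "eventually (\<lambda>m'. N (b j - restrict_seq {..<m'} (b j)) < e \<and> m < m') sequentially"
      by (intro eventually_conj eventually_gt_at_top)
    from eventually_happens'[OF sequentially_bot this]
    obtain m' where m': "N (b j - restrict_seq {..<m'} (b j)) < e" "m < m'" by blast
    have split: "b j - restrict_seq {m..<m'} (b j) =
        restrict_seq {..<m} (b j) + (b j - restrict_seq {..<m'} (b j))"
      using m'(2) by (auto simp: restrict_seq_def fun_eq_iff)
    have "restrict_seq A (b j) \<in> Y" if "finite A" for A
      using span_subset restrict_seq_in_span[OF that] by blast
    then have "N (b j - restrict_seq {m..<m'} (b j)) \<le> e + e"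
      unfolding split using j head m'(1) b diff_closed
      by (intro order_trans[OF N_triangle] add_mono) auto
    then show ?thesis using m'(2) by (auto simp: e_def)
  qed
  \<comment> \<open>A pair consists of an index of the sequence and the end of the block chosen for it.\<close>
  define Q where "Q i x y \<longleftrightarrow> snd x < snd y \<and>
    N (b (fst y) - restrict_seq {snd x..<snd y} (b (fst y))) \<le> (1/2) ^ i"
    for i :: nat and x y :: "nat \<times> nat"
  have "\<exists>y. Q i x y" for i x
    using step[of "snd x" i] by (auto simp: Q_def)
  then have "\<exists>f. \<forall>i. True \<and> Q i (f i) (f (Suc i))"
    using dependent_nat_choice[of "\<lambda>_ _. True" Q] by simp
  then obtain f where f: "\<And>i. snd (f i) < snd (f (Suc i))"
    "\<And>i. N (b (fst (f (Suc i))) - restrict_seq {snd (f i)..<snd (f (Suc i))} (b (fst (f (Suc i))))) \<le> (1/2) ^ i"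
    unfolding Q_def by blast
  show thesis
    by (rule that[of "\<lambda>i. snd (f i)" "\<lambda>i. fst (f (Suc i))"]) (use f in \<open>auto simp: strict_mono_Suc_iff\<close>)
qed

text \<open>
  The heart of the matter. On the disjoint blocks \<open>c i\<close> of a gliding hump, Hoelder's inequality
  bounds the \<open>p\<close>-th power of \<open>f (S (c i))\<close> by a multiple of the sum of \<open>norm (f (S (unit_vector n))) powr p\<close>
  over the \<open>i\<close>-th block. These sums add up over the blocks, so \<open>S (c i)\<close> is weakly
  \<open>p\<close>-summable and the Schur property makes it null.
\<close>

lemma Schur_operator_meets_neighborhood:
  assumes Schur: "p_Schur_property p smul" and S: "operator S"
    and b: "\<And>i. b i \<in> Y" "\<And>i. N (b i) \<le> M" and null: "\<And>n. (\<lambda>i. b i n) \<longlonglongrightarrow> 0"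
    and U: "open U" "0 \<in> U"
  shows "\<exists>i. S (b i) \<in> U"
proof -
  obtain m s where m: "strict_mono m" and
    err: "\<And>i. N (b (s i) - restrict_seq {m i..<m (Suc i)} (b (s i))) \<le> (1/2) ^ i"
    using gliding_hump[OF b(1) null] by metis
  define c where "c i = restrict_seq {m i..<m (Suc i)} (b (s i))" for i
  have c: "c i \<in> Y" for i
    using span_subset restrict_seq_in_span[of "{m i..<m (Suc i)}"] by (auto simp: c_def)
  have "weakly_p_summable p smul (\<lambda>i. S (c i))"
    unfolding weakly_p_summable_def
  proof
    fix f :: "'e \<Rightarrow> 'k" assume f: "f \<in> continuous_dual smul"
    define g where "g n = f (S (unit_vector n))" for n
    have g: "summable (\<lambda>n. norm (g n) powr p)"
      using operator_unit_vectors_weakly_summable[OF S] f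
      by (auto simp: weakly_p_summable_def lp_def g_def)
    define w where "w i = (\<Sum>n\<in>{m i..<m (Suc i)}. norm (g n) powr p)" for i
    have w: "0 \<le> w i" for i by (auto simp: w_def intro: sum_nonneg)
    have M: "0 \<le> M" using b(2)[of 0] N_nonneg[OF b(1)[of 0]] by linarith
    have le: "norm (f (S (c i))) powr p \<le> M powr p * w i" for i
    proof -
      have "f (S (c i)) = (\<Sum>n\<in>{m i..<m (Suc i)}. c i n * g n)"
        unfolding g_def by (rule functional_of_operator[OF S f]) (auto simp: c_def restrict_seq_def)
      also have "\<dots> = (\<Sum>n\<in>{m i..<m (Suc i)}. b (s i) n * g n)"
        by (intro sum.cong) (auto simp: c_def restrict_seq_def)
      finally have "norm (f (S (c i))) \<le> N (b (s i)) * w i powr (1 / p)"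
        unfolding w_def using Holder[OF b(1)] by simp
      also have "\<dots> \<le> M * w i powr (1 / p)" by (intro mult_right_mono b(2)) simp
      finally have "norm (f (S (c i))) powr p \<le> (M * w i powr (1 / p)) powr p"
        using p_ge_1 by (intro powr_mono2) auto
      then show ?thesis using p_ge_1 w[of i] by (simp add: powr_mult powr_powr)
    qed
    have "(\<Sum>i<K. w i) = (\<Sum>n\<in>{m 0..<m K}. norm (g n) powr p)" for K
    proof (induction K)
      case (Suc K)
      have "m 0 \<le> m K" "m K \<le> m (Suc K)" using m by (simp_all add: strict_mono_less_eq)
      then show ?case using Suc by (simp add: w_def sum.atLeastLessThan_concat)
    qed simp
    also have "(\<Sum>n\<in>{m 0..<m K}. norm (g n) powr p) \<le> (\<Sum>n. norm (g n) powr p)" for K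
      by (intro sum_le_suminf g) auto
    finally have "summable w"
      using w by (intro summableI_nonneg_bounded) auto
    then have "summable (\<lambda>i. M powr p * w i)" by (rule summable_mult)
    then have "summable (\<lambda>i. norm (f (S (c i))) powr p)"
      by (rule summable_comparison_test'[where N = 0]) (simp add: le)
    then show "(\<lambda>i. f (S (c i))) \<in> lp p" by (simp add: lp_def)
  qed
  then have main: "(\<lambda>i. S (c i)) \<longlonglongrightarrow> 0"
    using Schur by (simp add: p_Schur_property_def)
  have rest: "(\<lambda>i. S (b (s i) - c i)) \<longlonglongrightarrow> 0"
  proof (rule topological_tendstoI)
    fix V :: "'e set" assume "open V" "0 \<in> V"
    then obtain \<delta> where \<delta>: "\<delta> > 0" "\<And>a. a \<in> Y \<Longrightarrow> N a < \<delta> \<Longrightarrow> S a \<in> V"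
      using operator_small[OF S] by blast
    have "(\<lambda>i. (1/2) ^ i :: real) \<longlonglongrightarrow> 0" by (rule LIMSEQ_power_zero) simp
    then have "eventually (\<lambda>i. (1/2) ^ i < \<delta>) sequentially"
      using \<delta>(1) by (rule order_tendstoD(2))
    then show "eventually (\<lambda>i. S (b (s i) - c i) \<in> V) sequentially"
    proof (rule eventually_mono)
      fix i assume "(1/2) ^ i < \<delta>"
      then have "N (b (s i) - c i) < \<delta>" using err[of i] by (simp add: c_def)
      then show "S (b (s i) - c i) \<in> V" by (intro \<delta>(2) diff_closed b(1) c)
    qed
  qed
  have "S (b (s i)) = S (c i) + S (b (s i) - c i)" for i
    using operator_diff[OF S b(1) c] by simp
  then have "(\<lambda>i. S (b (s i))) \<longlonglongrightarrow> 0"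
    using tendsto_add[OF main rest] by simp
  then have "eventually (\<lambda>i. S (b (s i)) \<in> U) sequentially"
    using U by (rule topological_tendstoD)
  from eventually_happens'[OF sequentially_bot this] show ?thesis by blast
qed

text \<open>
  A coordinatewise Cauchy sequence in the unit ball has a Cauchy image: otherwise differences of its
  terms, which are bounded and coordinatewise null, would have images outside some neighborhood.
\<close>

lemma Schur_imp_sequentially_precompact:
  assumes Schur: "p_Schur_property p smul" and S: "operator S"
  shows "sequentially_precompact_operator top_Y S"
proof -
  define U where "U = {a \<in> Y. N a < 1}"
  have "zero_neighborhood top_Y U"
    unfolding zero_neighborhood_top_Y U_def by (auto intro: exI[of _ 1])
  moreover have "sequentially_precompact (S ` U)"
    unfolding sequentially_precompact_def
  proof (intro allI impI)
    fix y :: "nat \<Rightarrow> 'e" assume "range y \<subseteq> S ` U"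
    then have "\<forall>i. \<exists>a. a \<in> Y \<and> N a < 1 \<and> y i = S a" by (auto simp: U_def)
    from choice[OF this] obtain a where a: "\<And>i. a i \<in> Y" "\<And>i. N (a i) < 1" "\<And>i. y i = S (a i)"
      by blast
    have "norm (a i n) \<le> 1" for i n
      using coord_le[OF a(1), of i n] a(2)[of i] by simp
    then obtain r where r: "strict_mono (r :: nat \<Rightarrow> nat)" "\<And>n. Cauchy (\<lambda>i. a (r i) n)"
      using bounded_sequence_coordinatewise_Cauchy[of a 1] by metis
    have "Cauchy (y \<circ> r)"
      unfolding Cauchy_iff_nhds_0
    proof (intro allI impI, rule ccontr)
      fix V :: "'e set" assume V: "open V \<and> 0 \<in> V"
        and "\<not> (\<exists>K. \<forall>i\<ge>K. \<forall>j\<ge>K. (y \<circ> r) i - (y \<circ> r) j \<in> V)"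
      then have "\<forall>K. \<exists>ij. K \<le> fst ij \<and> K \<le> snd ij \<and> y (r (fst ij)) - y (r (snd ij)) \<notin> V"
        by auto
      from choice[OF this] obtain ij where
        ij: "\<And>K. K \<le> fst (ij K)" "\<And>K. K \<le> snd (ij K)"
          "\<And>K. y (r (fst (ij K))) - y (r (snd (ij K))) \<notin> V" by blast
      define b where "b K = a (r (fst (ij K))) - a (r (snd (ij K)))" for K
      have "\<exists>K. S (b K) \<in> V"
      proof (rule Schur_operator_meets_neighborhood[OF Schur S])
        show "b K \<in> Y" for K unfolding b_def by (intro diff_closed a)
        show "N (b K) \<le> 2" for K
          using N_triangle[of "a (r (fst (ij K)))" "- a (r (snd (ij K)))"] N_minus[OF a(1)]
            a(2)[of "r (fst (ij K))"] a(2)[of "r (snd (ij K))"] minus_closed[OF a(1)] a(1)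
          by (simp add: b_def)
        show "(\<lambda>K. b K n) \<longlonglongrightarrow> 0" for n
        proof (rule LIMSEQ_I)
          fix e :: real assume "0 < e"
          then obtain K0 where "\<forall>i\<ge>K0. \<forall>j\<ge>K0. norm (a (r i) n - a (r j) n) < e"
            using r(2)[of n] unfolding Cauchy_iff by blast
          then show "\<exists>K0. \<forall>K\<ge>K0. norm (b K n - 0) < e"
            using order_trans[OF _ ij(1)] order_trans[OF _ ij(2)]
            by (intro exI[of _ K0]) (simp add: b_def)
        qed
      qed (use V in auto)
      then show False using ij(3) a(1) by (simp add: b_def operator_diff[OF S] a(3))
    qed
    with r(1) show "\<exists>r. strict_mono r \<and> Cauchy (y \<circ> r)" by blast
  qed
  ultimately show ?thesis by (auto simp: sequentially_precompact_operator_def)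
qed

text \<open>
  By Hoelder's inequality the partial sums over the unit ball are weakly bounded, so Mackey's theorem
  applies; homogeneity gives the rest.
\<close>

lemma weakly_summable_partial_sums_bounded:
  assumes x: "weakly_p_summable p smul x" and q: "continuous_seminorm q"
  shows "\<exists>M. \<forall>a\<in>Y. \<forall>m. q (partial_sum x a m) \<le> M * N a"
proof -
  define B where "B = {partial_sum x a m | a m. a \<in> Y \<and> N a \<le> 1}"
  have "\<exists>M. \<forall>z\<in>B. q z \<le> M"
  proof (rule weakly_bounded_imp_bounded[OF q])
    fix f :: "'e \<Rightarrow> 'k" assume f: "f \<in> continuous_dual smul"
    then have s: "summable (\<lambda>n. norm (f (x n)) powr p)"
      using x by (auto simp: weakly_p_summable_def lp_def)
    have "norm (f (partial_sum x a m)) \<le> (\<Sum>n. norm (f (x n)) powr p) powr (1 / p)"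
      if a: "a \<in> Y" "N a \<le> 1" for a m
    proof -
      have "norm (f (partial_sum x a m)) \<le> N a * (\<Sum>n<m. norm (f (x n)) powr p) powr (1 / p)"
        unfolding partial_sum_def dual_sum[OF f] dual_linear(2)[OF f] by (rule Holder[OF a(1)]) simp
      also have "\<dots> \<le> 1 * (\<Sum>n. norm (f (x n)) powr p) powr (1 / p)"
        using a p_ge_1 by (intro mult_mono powr_mono2 sum_le_suminf s) (auto intro: sum_nonneg)
      finally show ?thesis by simp
    qed
    then show "\<exists>M. \<forall>z\<in>B. norm (f z) \<le> M" by (auto simp: B_def)
  qed
  then obtain M where M: "\<And>a m. a \<in> Y \<Longrightarrow> N a \<le> 1 \<Longrightarrow> q (partial_sum x a m) \<le> M"
    by (auto simp: B_def)
  have "q (partial_sum x a m) \<le> M * N a" if a: "a \<in> Y" for a m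
  proof (cases "N a = 0")
    case True
    then have "a n = 0" for n using coord_le[OF a, of n] by simp
    then have "partial_sum x a m = 0" by (simp add: partial_sum_def)
    then show ?thesis using True continuous_seminorm_scale[OF q, of 0 0] by simp
  next
    case False
    then have pos: "0 < N a" using N_nonneg[OF a] by simp
    let ?r = "inverse (N a)"
    have "N (seq_scale (of_real ?r) a) \<le> 1"
      using pos by (simp only: N_scale[OF a] norm_of_real) simp
    then have "q (partial_sum x (seq_scale (of_real ?r) a) m) \<le> M"
      by (intro M scale_closed[OF a])
    then have "?r * q (partial_sum x a m) \<le> M"
      using continuous_seminorm_scale[OF q, of ?r "partial_sum x a m"] pos
      unfolding partial_sum_scale by (simp del: of_real_inverse)
    then show ?thesis using pos by (simp add: field_simps)
  qed
  then show ?thesis by blast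
qed

lemma weakly_summable_partial_sums_Cauchy:
  assumes x: "weakly_p_summable p smul x" and a: "a \<in> Y"
  shows "Cauchy (partial_sum x a)"
  unfolding Cauchy_iff_nhds_0
proof (intro allI impI)
  fix U :: "'e set" assume "open U \<and> 0 \<in> U"
  then obtain q where q: "continuous_seminorm q" "{x. q x < 1} \<subseteq> U"
    using continuous_seminorm_small_in_open by blast
  obtain M where M: "\<And>a m. a \<in> Y \<Longrightarrow> q (partial_sum x a m) \<le> M * N a"
    using weakly_summable_partial_sums_bounded[OF x q(1)] by blast
  have "(\<lambda>k. M * N (a - restrict_seq {..<k} a)) \<longlonglongrightarrow> 0"
    using tendsto_mult_right_zero[OF N_tail[OF a]] by simp
  then have "eventually (\<lambda>k. M * N (a - restrict_seq {..<k} a) < 1) sequentially"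
    by (rule order_tendstoD(2)) simp
  then obtain K where K: "\<And>k. K \<le> k \<Longrightarrow> M * N (a - restrict_seq {..<k} a) < 1"
    by (auto simp: eventually_sequentially)
  have small: "q (partial_sum x a m - partial_sum x a k) < 1" if "K \<le> k" "k \<le> m" for k m
  proof -
    have "(\<Sum>n<m. smul ((a - restrict_seq {..<k} a) n) (x n)) = (\<Sum>n\<in>{k..<m}. smul (a n) (x n))"
      by (rule sum.mono_neutral_cong_right) (auto simp: restrict_seq_def)
    also have "\<dots> = partial_sum x a m - partial_sum x a k"
      using sum_diff_nat_ivl[of 0 k m "\<lambda>n. smul (a n) (x n)"] that
      by (simp add: partial_sum_def lessThan_atLeast0)
    finally have "partial_sum x a m - partial_sum x a k = partial_sum x (a - restrict_seq {..<k} a) m"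
      by (simp add: partial_sum_def)
    moreover have "a - restrict_seq {..<k} a \<in> Y"
      using span_subset restrict_seq_in_span[of "{..<k}" a] by (intro diff_closed a) auto
    ultimately show ?thesis
      using M[of "a - restrict_seq {..<k} a" m] K[OF that(1)] by simp
  qed
  have "partial_sum x a m - partial_sum x a k \<in> U" if "K \<le> m" "K \<le> k" for m k
  proof (cases "k \<le> m")
    case True
    then show ?thesis using small[OF that(2)] q(2) by auto
  next
    case False
    then have "q (- (partial_sum x a k - partial_sum x a m)) < 1"
      using small[OF that(1), of k] q(1) by (simp add: continuous_seminorm_def del: minus_diff_eq)
    then show ?thesis using q(2) by auto
  qed
  then show "\<exists>K. \<forall>m\<ge>K. \<forall>k\<ge>K. partial_sum x a m - partial_sum x a k \<in> U" by blast
qed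

text \<open>
  The convergence hypothesis holds trivially if \<open>Y\<close> consists of finitely supported sequences and by
  \<open>weakly_summable_partial_sums_Cauchy\<close> if the codomain is sequentially complete.
\<close>

lemma weakly_summable_operator:
  assumes x: "weakly_p_summable p smul x"
    and conv: "\<And>a. a \<in> Y \<Longrightarrow> convergent (partial_sum x a)"
  shows "\<exists>S. operator S \<and> (\<forall>n. S (unit_vector n) = x n)"
proof -
  define S where "S a = lim (partial_sum x a)" for a
  have lim: "partial_sum x a \<longlonglongrightarrow> S a" if "a \<in> Y" for a
    using conv[OF that] by (simp add: S_def convergent_LIMSEQ_iff)
  have "operator S"
  proof (rule operator_onI)
    show "S (a + b) = S a + S b" if "a \<in> Y" "b \<in> Y" for a b
      using tendsto_add[OF lim[OF that(1)] lim[OF that(2)]] lim[OF add_closed[OF that]]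
      by (intro LIMSEQ_unique) (simp_all add: partial_sum_add[abs_def])
    show "S (seq_scale c a) = smul c (S a)" if "a \<in> Y" for c a
      using tendsto_smul[OF lim[OF that], of c] lim[OF scale_closed[OF that], of c]
      by (intro LIMSEQ_unique) (simp_all add: partial_sum_scale[abs_def])
    fix q assume q: "continuous_seminorm q"
    obtain M where M: "\<And>a m. a \<in> Y \<Longrightarrow> q (partial_sum x a m) \<le> M * N a"
      using weakly_summable_partial_sums_bounded[OF x q] by blast
    have "q (S a) \<le> M * N a" if "a \<in> Y" for a
      using continuous_seminorm_continuous[OF q lim[OF that]] M[OF that]
      by (intro LIMSEQ_le_const2) auto
    then show "\<exists>M. \<forall>a\<in>Y. q (S a) \<le> M * N a" by blast
  qed
  moreover have "S (unit_vector n) = x n" for n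
  proof -
    have "partial_sum x (unit_vector n) m = x n" if "n < m" for m
    proof -
      have "smul (unit_vector n k) (x k) = (if k = n then x k else 0)" for k
        by (simp add: unit_vector_def)
      then show ?thesis using that by (simp add: partial_sum_def)
    qed
    then have "partial_sum x (unit_vector n) \<longlonglongrightarrow> x n"
      by (intro tendsto_eventually eventually_sequentiallyI[of "Suc n"]) auto
    then show ?thesis using lim[OF unit_vector_in] LIMSEQ_unique by blast
  qed
  ultimately show ?thesis by blast
qed

text \<open>
  Small multiples of the unit vectors lie in the neighborhood that is mapped to a precompact set.
  So every subsequence of \<open>x\<close> has a Cauchy subsequence, and that one is null because \<open>x\<close> is weakly
  null.
\<close>

lemma sequentially_precompact_imp_Schur:
  assumes precompact: "\<And>S. operator S \<Longrightarrow> sequentially_precompact_operator top_Y S"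
    and conv: "\<And>x a. weakly_p_summable p smul x \<Longrightarrow> a \<in> Y \<Longrightarrow> convergent (partial_sum x a)"
  shows "p_Schur_property p smul"
  unfolding p_Schur_property_def
proof (intro allI impI)
  fix x assume x: "weakly_p_summable p smul x"
  obtain S where S: "operator S" "\<And>n. S (unit_vector n) = x n"
    using weakly_summable_operator[OF x conv[OF x]] by blast
  obtain U where U: "zero_neighborhood top_Y U" "sequentially_precompact (S ` U)"
    using precompact[OF S(1)] by (auto simp: sequentially_precompact_operator_def)
  obtain \<delta> where \<delta>: "\<delta> > 0" "\<And>a. a \<in> Y \<Longrightarrow> N a < \<delta> \<Longrightarrow> a \<in> U"
    using U(1) unfolding zero_neighborhood_top_Y by blast
  have "rscale (\<delta> / 2) (x n) \<in> S ` U" for n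
  proof -
    let ?a = "seq_scale (of_real (\<delta> / 2)) (unit_vector n) :: nat \<Rightarrow> 'k"
    have "N ?a \<le> \<delta> / 2"
      using N_scale[OF unit_vector_in, of "of_real (\<delta> / 2)" n] N_unit_vector_le[of n] \<delta>(1)
        mult_left_le[of "N (unit_vector n)" "\<delta> / 2"] by (simp del: of_real_divide)
    then have "?a \<in> U" using \<delta> scale_closed[OF unit_vector_in] by (intro \<delta>(2)) auto
    then show ?thesis
      using operator_scale[OF S(1) unit_vector_in, of "of_real (\<delta> / 2)" n] S(2)[of n] by force
  qed
  then have pre: "\<exists>k. strict_mono k \<and> Cauchy ((\<lambda>n. rscale (\<delta> / 2) (x (r n))) \<circ> k)" for r :: "nat \<Rightarrow> nat"
    using U(2) unfolding sequentially_precompact_def by (simp add: image_subset_iff)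
  show "x \<longlonglongrightarrow> 0"
  proof (rule ccontr)
    assume "\<not> x \<longlonglongrightarrow> 0"
    then obtain V where V: "open V" "0 \<in> V" "\<not> eventually (\<lambda>n. x n \<in> V) sequentially"
      by (auto simp: tendsto_def)
    then have "infinite {n. x n \<notin> V}"
      by (simp add: not_eventually frequently_cofinite flip: cofinite_eq_sequentially)
    define r where "r = enumerate {n. x n \<notin> V}"
    have r: "strict_mono r" "\<And>n. x (r n) \<notin> V"
      using \<open>infinite {n. x n \<notin> V}\<close> enumerate_in_set[OF \<open>infinite {n. x n \<notin> V}\<close>]
      by (auto simp: r_def strict_mono_enumerate)
    obtain k where k: "strict_mono k" "Cauchy (\<lambda>n. rscale (\<delta> / 2) (x (r (k n))))"
      using pre[of r] by (auto simp: o_def)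
    have rk: "strict_mono (\<lambda>n. r (k n))"
      using strict_mono_o[OF r(1) k(1)] by (simp add: o_def)
    have "(\<lambda>n. rscale (\<delta> / 2) (x (r (k n)))) \<longlonglongrightarrow> 0"
    proof (rule weakly_null_Cauchy_imp_null[OF k(2)])
      fix f :: "'e \<Rightarrow> 'k" assume f: "f \<in> continuous_dual smul"
      have "(\<lambda>n. f (x (r (k n)))) \<longlonglongrightarrow> 0"
        using LIMSEQ_subseq_LIMSEQ[OF weakly_summable_imp_weakly_null[OF _ x f] rk] p_ge_1 by (simp add: o_def)
      then show "(\<lambda>n. f (rscale (\<delta> / 2) (x (r (k n))))) \<longlonglongrightarrow> 0"
        unfolding dual_linear(2)[OF f] by (rule tendsto_mult_right_zero)
    qed
    from tendsto_smul[OF this, of "of_real (2 / \<delta>)"]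
    have "(\<lambda>n. x (r (k n))) \<longlonglongrightarrow> 0" using \<delta>(1) by simp
    then have "eventually (\<lambda>n. x (r (k n)) \<in> V) sequentially"
      using V by (simp add: topological_tendstoD)
    then show False using r(2) by (auto simp: eventually_sequentially)
  qed
qed

end

section \<open>The equivalences\<close>

lemma sequentially_complete_precompact_iff:
  assumes "sequentially_complete TYPE('e::uniform_space)"
  shows "sequentially_precompact_operator T S \<longleftrightarrow>
    sequentially_compact_operator T (S :: 'y::zero \<Rightarrow> 'e)"
proof -
  have "Cauchy x \<longleftrightarrow> convergent x" for x :: "nat \<Rightarrow> 'e"
    using assms convergent_Cauchy by (auto simp: sequentially_complete_def)
  then show ?thesis
    by (simp add: sequentially_precompact_operator_def sequentially_compact_operator_def
        sequentially_precompact_def relatively_sequentially_compact_def)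
qed

lemma Schur_iff_operators_sequentially_precompact:
  fixes smul :: "'k::real_or_complex_field \<Rightarrow>
      'e::{uniform_topological_group_add, ab_group_add, t2_space} \<Rightarrow> 'e"
  assumes E: "locally_convex_space smul" and X: "normed_sequence_space X N p"
  defines "T \<equiv> Metric_space.mtopology X (\<lambda>a b. N (\<lambda>n. a n - b n))"
  shows "p_Schur_property p smul \<longleftrightarrow> (\<forall>S. operator_on (subtopology T unit_vector_span) seq_scale smul S \<longrightarrow>
      sequentially_precompact_operator (subtopology T unit_vector_span) S)" (is "?Schur \<longleftrightarrow> ?span")
    and "sequentially_complete TYPE('e) \<Longrightarrow>
      p_Schur_property p smul \<longleftrightarrow> (\<forall>S. operator_on T seq_scale smul S \<longrightarrow> sequentially_precompact_operator T S)"
proof -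
  interpret E: locally_convex_space smul by (rule E)
  interpret X: operator_setting X N p smul
    by (intro operator_setting.intro E X)
  interpret X0: operator_setting unit_vector_span N p smul
    by (intro operator_setting.intro E normed_sequence_space_span[OF X])
  have sub: "subtopology T unit_vector_span = X0.top_Y"
    unfolding T_def by (rule subtopology_mtopology[OF X.metric X.span_subset])
  have "convergent (E.partial_sum x a)" if "a \<in> unit_vector_span" for x and a :: "nat \<Rightarrow> 'k"
  proof -
    have "finite {n. a n \<noteq> 0}" using that by (simp add: unit_vector_span_eq)
    then obtain K where K: "\<And>n. a n \<noteq> 0 \<Longrightarrow> n < K"
      unfolding finite_nat_set_iff_bounded by blast
    have "E.partial_sum x a m = E.partial_sum x a K" if "K \<le> m" for m
      unfolding E.partial_sum_def using that K
      by (intro sum.mono_neutral_right ballI) (auto simp: not_le dest: leD)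
    then have "E.partial_sum x a \<longlonglongrightarrow> E.partial_sum x a K"
      by (intro tendsto_eventually eventually_sequentiallyI[of K])
    then show ?thesis by (rule convergentI)
  qed
  then show "?Schur \<longleftrightarrow> ?span"
    unfolding sub using X0.Schur_imp_sequentially_precompact X0.sequentially_precompact_imp_Schur by blast
  assume "sequentially_complete TYPE('e)"
  then have "convergent (E.partial_sum x a)" if "weakly_p_summable p smul x" "a \<in> X" for x a
    using X.weakly_summable_partial_sums_Cauchy[OF that] by (simp add: sequentially_complete_def)
  then show "?Schur \<longleftrightarrow> (\<forall>S. operator_on T seq_scale smul S \<longrightarrow> sequentially_precompact_operator T S)"
    unfolding T_def using X.Schur_imp_sequentially_precompact X.sequentially_precompact_imp_Schur by blast
qed

theorem corollary13p23:
  fixes smul :: "'k::real_or_complex_field \<Rightarrow>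
      'e::{uniform_topological_group_add, ab_group_add, t2_space} \<Rightarrow> 'e"
    and p :: real
  assumes "locally_convex_space smul"
    and "1 \<le> p"
  shows
    "let q = conjugate_exponent p;
         c1 = p_convergent_map p smul smul id;
         c2 = (\<forall>S. operator_on (if p = 1 then c00_topology else lp0_topology q) seq_scale smul S \<longrightarrow>
                sequentially_precompact_operator (if p = 1 then c00_topology else lp0_topology q) S);
         c3 = (\<forall>S. operator_on (if p = 1 then c0_topology else lp_topology q) seq_scale smul S \<longrightarrow>
                sequentially_precompact_operator (if p = 1 then c0_topology else lp_topology q) S);
         c4 = (\<forall>S. operator_on (lp_topology q) seq_scale smul S \<longrightarrow>
                sequentially_compact_operator (lp_topology q) S);
         c5 = (\<forall>S. operator_on c0_topology seq_scale smul S \<longrightarrow>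
                sequentially_compact_operator c0_topology S)
     in (c1 \<longleftrightarrow> p_Schur_property p smul) \<and>
        (c1 \<longleftrightarrow> c2) \<and>
        (sequentially_complete TYPE('e) \<longrightarrow> (c1 \<longleftrightarrow> c3)) \<and>
        (1 < p \<and> sequentially_complete TYPE('e) \<longrightarrow> (c1 \<longleftrightarrow> c4)) \<and>
        (p = 1 \<and> sequentially_complete TYPE('e) \<and> weakly_sequentially_p_complete 1 smul \<longrightarrow>
          (c1 \<longleftrightarrow> c5))"
proof -
  interpret locally_convex_space smul by fact
  have c1: "p_convergent_map p smul smul id \<longleftrightarrow> p_Schur_property p smul"
    using linear_id by (simp add: p_convergent_map_def p_Schur_property_def id_def)
  note complete = sequentially_complete_precompact_iff[where 'e = 'e]
  show ?thesis
  proof (cases "p = 1")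
    case True
    note Schur = Schur_iff_operators_sequentially_precompact[OF assms(1) normed_sequence_space_c0,
        folded c0_topology_def, folded c00_topology_def]
    show ?thesis
      using Schur complete True unfolding Let_def c1 by auto
  next
    case False
    then have p: "1 < p" using assms(2) by simp
    note Schur = Schur_iff_operators_sequentially_precompact[OF assms(1)
        normed_sequence_space_lp[OF p conjugate_exponent(2)[OF p] conjugate_exponent(1)[OF p]],
        folded lp_topology_def, folded lp0_topology_def]
    show ?thesis
      using Schur complete False unfolding Let_def c1 by auto
  qed
qed

end
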